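(* Let $r\ge1$ be a fixed integer, and at each generation $n$ sample $r_n=r$ individuals. Under Assumptions A1, A2 and A3 (and the Kesten–Stigum convergence $\bm Z_n\rho^{-n}\to\bm bW$ a.s. with $W>0$ a.s.), for all $\bm u_1,\dots,\bm u_r\in\mathbb N^l$, $$\mathbb P(\bm X_{n,w}=\bm u_w \text{ for all } w\in\{1,\dots,r\})\to\prod_{w=1}^r p_S(\bm u_w)\quad\text{as } n\to\infty.$$
   Context: Fix an integer $l\ge 2$, let $\mathbb N=\{0,1,2,\dots\}$, and for $\bm x\in\mathbb R^l$ let $|\bm x|=\sum_{i=1}^l|x_i|$. Let $p_1,\dots,p_l$ be probability mass functions on $\mathbb N^l$. The multitype Galton–Watson process $(\bm Z_n)_{n\ge0}$, $\bm Z_n=(Z_{n,1},\dots,Z_{n,l})$, is defined by $\bm Z_0$ equal to a fixed canonical basis vector and $\bm Z_n=\sum_{j=1}^l\sum_{i=1}^{Z_{n-1,j}}\bm Y^{(j)}_{n-1,i}$, where the offspring vectors $\bm Y^{(j)}_{n-1,i}$ are mutually independent and $\bm Y^{(j)}_{n-1,i}$ has law $p_j$; $\bm Y^{(i)}$ denotes a generic vector with law $p_i$. The mean matrix $M$ has entries $M_{ik}=\mathbb E(Y^{(i)}_k)$. Assumption A1: for every $j$, $p_j(\bm 0)=0$ and $\sum_{k=1}^l p_j(\bm e_k)<1$. Assumption A2: $M$ is positively regular and its largest eigenvalue $\rho$ satisfies $\rho>1$; $\bm b=(b_1,\dots,b_l)$ is the left eigenvector for $\rho$ with nonnegative entries and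 $|\bm b|=1$ ($\bm b^TM=\rho\bm b^T$). Sampling: at generation $n$ a sample of $r_n$ individuals is drawn uniformly at random without replacement among the $|\bm Z_n|$ individuals of generation $n$; the $t$-th sampled individual reports $\bm X_{n,t}$, the offspring vector of its parent in generation $n-1$. Assumption A3: (i) $r_n^2\rho^{-n}\to0$; (ii) there is $C$ with $\mathbb E(|\bm Y^{(i)}|^2)\le C$ for all $i$; (iii) there is $K$ with $\mathbb E(|\bm Y^{(i)}|^{-1})\le K$ for all $i$. The size-biased distribution is the probability mass function on $\mathbb N^l$ given by $p_S(\bm u)=\frac{|\bm u|}{\rho}\sum_{i=1}^l b_ip_i(\bm u)$. *)

theory Defs
  imports "HOL-Probability.Probability"
begin

text \<open>Types are indexed by 0..<l; vectors in N^l are functions nat => nat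
  (components k >= l are irrelevant / zero).\<close>

definition vnorm :: "nat \<Rightarrow> (nat \<Rightarrow> nat) \<Rightarrow> nat" where
  "vnorm l u = (\<Sum>k<l. u k)"

definition in_Nl :: "nat \<Rightarrow> (nat \<Rightarrow> nat) \<Rightarrow> bool" where
  "in_Nl l u \<longleftrightarrow> (\<forall>k\<ge>l. u k = 0)"

definition unitvec :: "nat \<Rightarrow> nat \<Rightarrow> nat" where
  "unitvec k = (\<lambda>j. if j = k then 1 else 0)"

definition mean_matrix :: "(nat \<Rightarrow> (nat \<Rightarrow> nat) pmf) \<Rightarrow> nat \<Rightarrow> nat \<Rightarrow> real" where
  "mean_matrix p i k = measure_pmf.expectation (p i) (\<lambda>u. real (u k))"

fun matpow :: "nat \<Rightarrow> (nat \<Rightarrow> nat \<Rightarrow> real) \<Rightarrow> nat \<Rightarrow> nat \<Rightarrow> nat \<Rightarrow> real" where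
  "matpow l A 0 = (\<lambda>i k. if i = k then 1 else 0)"
| "matpow l A (Suc m) = (\<lambda>i k. \<Sum>j<l. matpow l A m i j * A j k)"

definition positively_regular :: "nat \<Rightarrow> (nat \<Rightarrow> nat \<Rightarrow> real) \<Rightarrow> bool" where
  "positively_regular l A \<longleftrightarrow> (\<exists>m>0. \<forall>i<l. \<forall>k<l. matpow l A m i k > 0)"

definition is_eigenvalue :: "nat \<Rightarrow> (nat \<Rightarrow> nat \<Rightarrow> real) \<Rightarrow> complex \<Rightarrow> bool" where
  "is_eigenvalue l A mu \<longleftrightarrow>
     (\<exists>v :: nat \<Rightarrow> complex. (\<exists>k<l. v k \<noteq> 0) \<and>
        (\<forall>i<l. (\<Sum>k<l. complex_of_real (A i k) * v k) = mu * v i))"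

definition largest_eigenvalue :: "nat \<Rightarrow> (nat \<Rightarrow> nat \<Rightarrow> real) \<Rightarrow> real \<Rightarrow> bool" where
  "largest_eigenvalue l A \<rho> \<longleftrightarrow>
     is_eigenvalue l A (complex_of_real \<rho>) \<and> (\<forall>mu. is_eigenvalue l A mu \<longrightarrow> cmod mu \<le> \<rho>)"

fun draw_all :: "('a \<Rightarrow> 'b pmf) \<Rightarrow> 'a list \<Rightarrow> 'b list pmf" where
  "draw_all f [] = return_pmf []"
| "draw_all f (x # xs) = bind_pmf (f x) (\<lambda>y. map_pmf (\<lambda>ys. y # ys) (draw_all f xs))"

text \<open>An individual is a pair (type, offspring vector of its parent).
  A parent with offspring vector Y has Y k children of type k, each reporting Y.\<close>
definition children :: "nat \<Rightarrow> (nat \<Rightarrow> nat) \<Rightarrow> (nat \<times> (nat \<Rightarrow> nat)) list" where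
  "children l Y = concat (map (\<lambda>k. replicate (Y k) (k, Y)) [0..<l])"

definition next_gen :: "nat \<Rightarrow> (nat \<Rightarrow> (nat \<Rightarrow> nat) pmf) \<Rightarrow>
    (nat \<times> (nat \<Rightarrow> nat)) list \<Rightarrow> (nat \<times> (nat \<Rightarrow> nat)) list pmf" where
  "next_gen l p xs = map_pmf (\<lambda>Ys. concat (map (children l) Ys)) (draw_all (\<lambda>x. p (fst x)) xs)"

text \<open>Law of the list of individuals of generation n, started from one individual
  of type i0 (Z_0 = e_{i0}); the root's label is irrelevant.\<close>
fun generation :: "nat \<Rightarrow> (nat \<Rightarrow> (nat \<Rightarrow> nat) pmf) \<Rightarrow> nat \<Rightarrow> nat \<Rightarrow>
    (nat \<times> (nat \<Rightarrow> nat)) list pmf" where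
  "generation l p i0 0 = return_pmf [(i0, \<lambda>_. 0)]"
| "generation l p i0 (Suc n) = bind_pmf (generation l p i0 n) (next_gen l p)"

definition sample_reports :: "nat \<Rightarrow> (nat \<Rightarrow> (nat \<Rightarrow> nat) pmf) \<Rightarrow> nat \<Rightarrow> nat \<Rightarrow> nat \<Rightarrow>
    (nat \<Rightarrow> nat) list option pmf" where
  "sample_reports l p i0 r n =
     bind_pmf (generation l p i0 n) (\<lambda>xs.
       if r \<le> length xs then
         map_pmf (\<lambda>is. Some (map (\<lambda>j. snd (xs ! j)) is))
           (pmf_of_set {is. distinct is \<and> length is = r \<and> set is \<subseteq> {..<length xs}})
       else return_pmf None)"

definition size_biased :: "nat \<Rightarrow> (nat \<Rightarrow> (nat \<Rightarrow> nat) pmf) \<Rightarrow> (nat \<Rightarrow> real) \<Rightarrow> real \<Rightarrow>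
    (nat \<Rightarrow> nat) \<Rightarrow> real" where
  "size_biased l p b \<rho> u = real (vnorm l u) / \<rho> * (\<Sum>i<l. b i * pmf (p i) u)"

end

theory Submission
  imports Defs
begin

text \<open>Call \<open>S g\<close> the sum of a bounded function \<open>g\<close> over the individuals of a generation, and let \<open>\<mu> i\<close> be the
  expected value of \<open>S g\<close> over the children of one parent of type \<open>i\<close>. If \<open>b \<bullet> \<mu> < 0\<close>, then by a Perron-Frobenius
  argument \<open>M ^ m \<mu>\<close> is entrywise negative for some \<open>m\<close>. Conditionally on generation \<open>n\<close>, the sum \<open>S g\<close> at
  generation \<open>n + m + 1\<close> then has a mean below \<open>- d |Z n|\<close> with \<open>d > 0\<close> and a variance of order \<open>|Z n|\<close>. Since
  \<open>E (1 / |Z n|)\<close> decays geometrically, Chebyshev's inequality shows \<open>S g < 0\<close> with probability tending to 1; no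
  Kesten-Stigum theorem is needed. Applied to \<open>g = \<plusminus> (1[label = u] - p\<^sub>S u) - \<epsilon>\<close>, this says that the
  proportion of individuals reporting \<open>u\<close> tends to \<open>p\<^sub>S u\<close> in probability. Sampling without replacement
  differs from sampling with replacement by an error that vanishes as \<open>|Z n|\<close> grows.\<close>

section \<open>A Perron-Frobenius estimate\<close>

text \<open>The left eigenvector \<open>b\<close> is the only spectral input: pairing with it is
  multiplied by exactly \<gamma> at each step. The sequence \<open>v\<close> is constrained only on
  indices below \<open>l\<close>, so it can later be a subsequence of matrix iterates.\<close>

lemma negative_iterate_of_positive_matrix:
  fixes A :: "nat \<Rightarrow> nat \<Rightarrow> real" and v :: "nat \<Rightarrow> nat \<Rightarrow> real"
  assumes l: "l > 0" and \<gamma>: "\<gamma> > 0"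
    and A_pos: "\<And>i k. i < l \<Longrightarrow> k < l \<Longrightarrow> A i k > 0"
    and b_nonneg: "\<And>k. k < l \<Longrightarrow> b k \<ge> 0" and b_sum: "(\<Sum>k<l. b k) = 1"
    and b_eigen: "\<And>k. k < l \<Longrightarrow> (\<Sum>i<l. b i * A i k) = \<gamma> * b k"
    and v_Suc: "\<And>n i. i < l \<Longrightarrow> v (Suc n) i = (\<Sum>k<l. A i k * v n k)"
    and neg: "(\<Sum>k<l. b k * v 0 k) < 0"
  shows "\<exists>n. \<forall>i<l. v n i < 0"
proof -
  define entries where "entries = (\<lambda>(i, k). A i k) ` ({..<l} \<times> {..<l})"
  have entries: "finite entries" "entries \<noteq> {}" and mem: "\<And>i k. i < l \<Longrightarrow> k < l \<Longrightarrow> A i k \<in> entries"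
    using l by (auto simp: entries_def)
  define \<delta> where "\<delta> = Min entries"
  define D where "D = Max entries"
  have \<delta>_pos: "\<delta> > 0"
    unfolding \<delta>_def using entries A_pos by (subst Min_gr_iff) (auto simp: entries_def)
  have \<delta>_le: "\<And>i k. i < l \<Longrightarrow> k < l \<Longrightarrow> \<delta> \<le> A i k" and le_D: "\<And>i k. i < l \<Longrightarrow> k < l \<Longrightarrow> A i k \<le> D"
    using entries mem by (auto simp: \<delta>_def D_def)
  have D_pos: "D > 0" using \<delta>_le[of 0 0] le_D[of 0 0] l \<delta>_pos by linarith
  have b_le1: "b k \<le> 1" if "k < l" for k
    using that b_nonneg b_sum member_le_sum[of k "{..<l}" b] by auto
  \<comment> \<open>As \<open>b\<close> has total mass 1, the eigenvector equation bounds
    \<open>\<gamma> * b k\<close> below by a weighted average of entries of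
    \<open>A\<close>.\<close>
  have b_lower: "\<delta> \<le> \<gamma> * b k" if k: "k < l" for k
  proof -
    have "\<delta> = (\<Sum>i<l. b i * \<delta>)" using b_sum by (simp flip: sum_distrib_right)
    also have "\<dots> \<le> (\<Sum>i<l. b i * A i k)"
      using k b_nonneg \<delta>_le by (intro sum_mono mult_left_mono) auto
    finally show ?thesis using b_eigen k by simp
  qed
  \<comment> \<open>The value \<open>\<delta> / \<gamma>\<close> together with
    \<open>b k \<le> 1\<close> keeps \<open>A'\<close> below nonnegative; the cap 1/2 keeps
    \<open>1 - \<eta>\<close> strictly between 0 and 1.\<close>
  define \<eta> where "\<eta> = min (\<delta> / \<gamma>) (1/2)"
  have \<eta>: "\<eta> > 0" "\<eta> < 1" "\<gamma> * \<eta> \<le> \<delta>"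
    using \<delta>_pos \<gamma> by (auto simp: \<eta>_def min_def field_simps)
  \<comment> \<open>Doeblin splitting \<open>A = \<gamma> \<eta> 1 b\<^sup>T + A'\<close>: the rank-one part pushes every entry down at rate \<open>\<gamma> ^ n\<close>, while the
    \<open>b\<close>-weight of the positive part is only carried by \<open>A'\<close> and grows at the smaller rate \<open>(\<gamma> (1 - \<eta>)) ^ n\<close>.\<close>
  define A' where "A' i k = A i k - \<gamma> * \<eta> * b k" for i k
  have A'_nonneg: "A' i k \<ge> 0" if "i < l" "k < l" for i k
  proof -
    have "\<gamma> * \<eta> * b k \<le> \<gamma> * \<eta> * 1" using that b_le1 \<eta> \<gamma> by (intro mult_left_mono) auto
    then show ?thesis using \<delta>_le[OF that] \<eta> by (simp add: A'_def)
  qed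
  \<comment> \<open>Since \<open>b k\<close> is at least \<open>\<delta> / \<gamma>\<close>, this
    factor turns the uniform bound \<open>D\<close> into a multiple of \<open>b k\<close>, so that
    \<open>A'\<close> applied to a positive part is controlled by the scalar
    \<open>P n\<close>.\<close>
  define K where "K = D * \<gamma> / \<delta>"
  have K_pos: "K > 0" using D_pos \<delta>_pos \<gamma> by (simp add: K_def)
  have A'_le: "A' i k \<le> K * b k" if "i < l" "k < l" for i k
  proof -
    have "A' i k \<le> D" using le_D[OF that] \<eta> \<gamma> b_nonneg[OF that(2)] 
      by (smt (verit) A'_def mult_nonneg_nonneg)
    also have "D \<le> D * (\<gamma> * b k / \<delta>)"
      using b_lower[OF that(2)] D_pos \<delta>_pos mult_left_mono[of 1 "\<gamma> * b k / \<delta>" D] by simp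
    finally show ?thesis by (simp add: K_def)
  qed
  have b_A': "(\<Sum>i<l. b i * A' i k) = \<gamma> * (1 - \<eta>) * b k" if "k < l" for k
  proof -
    have "(\<Sum>i<l. b i * A' i k) = (\<Sum>i<l. b i * A i k) - (\<Sum>i<l. b i) * (\<gamma> * \<eta> * b k)"
      by (simp add: A'_def right_diff_distrib sum_subtractf sum_distrib_right)
    then show ?thesis using b_eigen[OF that] b_sum by (simp add: algebra_simps)
  qed
  define \<epsilon> where "\<epsilon> = - (\<Sum>k<l. b k * v 0 k)"
  have \<epsilon>: "\<epsilon> > 0" using neg by (simp add: \<epsilon>_def)
  have bv: "(\<Sum>k<l. b k * v n k) = - \<epsilon> * \<gamma> ^ n" for n
  proof (induction n)
    case (Suc n)
    have "(\<Sum>k<l. b k * v (Suc n) k) = (\<Sum>i<l. \<Sum>k<l. b i * A i k * v n k)"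
      by (simp add: v_Suc sum_distrib_left mult.assoc)
    also have "\<dots> = (\<Sum>k<l. (\<Sum>i<l. b i * A i k) * v n k)"
      by (subst sum.swap) (simp add: sum_distrib_right)
    also have "\<dots> = \<gamma> * (\<Sum>k<l. b k * v n k)" by (simp add: b_eigen sum_distrib_left mult.assoc)
    finally show ?case using Suc by simp
  qed (simp add: \<epsilon>_def)
  define P where "P n = (\<Sum>k<l. b k * max (v n k) 0)" for n
  have P_nonneg: "P n \<ge> 0" for n unfolding P_def using b_nonneg by (intro sum_nonneg) auto
  \<comment> \<open>The rank-one part is evaluated exactly by \<open>bv\<close>; in the remainder
    the negative entries of \<open>v n\<close> are discarded.\<close>
  have v_step: "v (Suc n) i \<le> - (\<gamma> * \<eta> * \<epsilon> * \<gamma> ^ n) + (\<Sum>k<l. A' i k * max (v n k) 0)" if i: "i < l" for n i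
  proof -
    have "v (Suc n) i = (\<Sum>k<l. \<gamma> * \<eta> * (b k * v n k)) + (\<Sum>k<l. A' i k * v n k)"
      unfolding sum.distrib[symmetric] v_Suc[OF i] by (intro sum.cong) (auto simp: A'_def algebra_simps)
    also have "(\<Sum>k<l. \<gamma> * \<eta> * (b k * v n k)) = - (\<gamma> * \<eta> * \<epsilon> * \<gamma> ^ n)"
      by (simp add: bv flip: sum_distrib_left)
    also have "(\<Sum>k<l. A' i k * v n k) \<le> (\<Sum>k<l. A' i k * max (v n k) 0)"
      using i A'_nonneg by (intro sum_mono mult_left_mono) auto
    finally show ?thesis by simp
  qed
  have P_Suc: "P (Suc n) \<le> \<gamma> * (1 - \<eta>) * P n" for n
  proof -
    have "max (v (Suc n) i) 0 \<le> (\<Sum>k<l. A' i k * max (v n k) 0)" if i: "i < l" for i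
    proof -
      have "\<gamma> * \<eta> * \<epsilon> * \<gamma> ^ n \<ge> 0" using \<gamma> \<eta> \<epsilon> by simp
      moreover have "(\<Sum>k<l. A' i k * max (v n k) 0) \<ge> 0"
        using i A'_nonneg by (intro sum_nonneg mult_nonneg_nonneg) auto
      ultimately show ?thesis using v_step[OF i, of n] by simp
    qed
    then have "P (Suc n) \<le> (\<Sum>i<l. b i * (\<Sum>k<l. A' i k * max (v n k) 0))"
      unfolding P_def using b_nonneg by (intro sum_mono mult_left_mono) auto
    also have "\<dots> = (\<Sum>k<l. (\<Sum>i<l. b i * A' i k) * max (v n k) 0)"
      unfolding sum_distrib_left sum_distrib_right by (subst sum.swap) (simp add: mult.assoc)
    also have "\<dots> = \<gamma> * (1 - \<eta>) * P n" by (simp add: b_A' P_def sum_distrib_left mult.assoc)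
    finally show ?thesis .
  qed
  have P_le: "P n \<le> (\<gamma> * (1 - \<eta>)) ^ n * P 0" for n
  proof (induction n)
    case (Suc n)
    have "P (Suc n) \<le> \<gamma> * (1 - \<eta>) * ((\<gamma> * (1 - \<eta>)) ^ n * P 0)"
      using P_Suc[of n] Suc \<gamma> \<eta> by (smt (verit) mult_left_mono mult_nonneg_nonneg)
    then show ?case by (simp add: mult.assoc)
  qed simp
  \<comment> \<open>After division by \<open>\<gamma> ^ n\<close> the downward push is constant
    while the positive contribution decays geometrically.\<close>
  have "(\<lambda>n. K * P 0 * (1 - \<eta>) ^ n) \<longlonglongrightarrow> K * P 0 * 0"
    using \<eta> by (intro tendsto_intros LIMSEQ_realpow_zero) auto
  moreover have "\<gamma> * \<eta> * \<epsilon> > 0" using \<gamma> \<eta> \<epsilon> by simp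
  ultimately have "\<forall>\<^sub>F n in sequentially. K * P 0 * (1 - \<eta>) ^ n < \<gamma> * \<eta> * \<epsilon>"
    by (intro order_tendstoD(2)) auto
  then obtain n where n: "K * P 0 * (1 - \<eta>) ^ n < \<gamma> * \<eta> * \<epsilon>"
    by (auto simp: eventually_sequentially)
  have "v (Suc n) i < 0" if i: "i < l" for i
  proof -
    have "(\<Sum>k<l. A' i k * max (v n k) 0) \<le> (\<Sum>k<l. K * (b k * max (v n k) 0))"
      using A'_le[OF i] by (intro sum_mono) (auto simp: mult.assoc[symmetric] intro: mult_right_mono)
    also have "\<dots> = K * P n" by (simp add: P_def sum_distrib_left)
    also have "\<dots> \<le> K * ((\<gamma> * (1 - \<eta>)) ^ n * P 0)" using P_le K_pos by simp
    also have "\<dots> = (K * P 0 * (1 - \<eta>) ^ n) * \<gamma> ^ n" by (simp add: power_mult_distrib)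
    also have "\<dots> < (\<gamma> * \<eta> * \<epsilon>) * \<gamma> ^ n" using n \<gamma> by (intro mult_strict_right_mono) auto
    finally show ?thesis using v_step[OF i, of n] by simp
  qed
  then show ?thesis by blast
qed

section \<open>From entrywise positive to positively regular matrices\<close>

definition apply_mat :: "nat \<Rightarrow> (nat \<Rightarrow> nat \<Rightarrow> real) \<Rightarrow> (nat \<Rightarrow> real) \<Rightarrow> nat \<Rightarrow> real" where
  "apply_mat l A v i = (\<Sum>k<l. A i k * v k)"

lemma funpow_apply_mat:
  "i < l \<Longrightarrow> (apply_mat l A ^^ m) v i = apply_mat l (matpow l A m) v i"
proof (induction m arbitrary: v)
  case 0
  have "(\<Sum>k<l. (if i = k then 1 else 0) * v k) = (\<Sum>k<l. if i = k then v k else 0)"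
    by (intro sum.cong) auto
  then show ?case using 0 by (simp add: apply_mat_def)
next
  case (Suc m)
  \<comment> \<open>\<open>matpow\<close> adds its new factor on the right, so the iterate is
    unrolled from the inside.\<close>
  have "(apply_mat l A ^^ Suc m) v i = apply_mat l (matpow l A m) (apply_mat l A v) i"
    using Suc by (simp only: funpow_Suc_right o_apply)
  also have "\<dots> = (\<Sum>j<l. \<Sum>k<l. matpow l A m i j * A j k * v k)"
    by (simp add: apply_mat_def sum_distrib_left mult.assoc)
  also have "\<dots> = apply_mat l (matpow l A (Suc m)) v i"
    by (subst sum.swap) (simp add: apply_mat_def sum_distrib_right)
  finally show ?case .
qed

lemma matpow_left_eigen:
  assumes "\<And>k. k < l \<Longrightarrow> (\<Sum>i<l. b i * A i k) = \<gamma> * b k" and "k < l"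
  shows "(\<Sum>i<l. b i * matpow l A m i k) = \<gamma> ^ m * (b k :: real)"
  using assms(2)
proof (induction m arbitrary: k)
  case 0
  have "(\<Sum>i<l. b i * (if i = k then 1 else 0)) = (\<Sum>i<l. if k = i then b i else 0)"
    by (intro sum.cong) auto
  then show ?case using 0 by simp
next
  case (Suc m)
  have "(\<Sum>i<l. b i * matpow l A (Suc m) i k) = (\<Sum>i<l. \<Sum>j<l. b i * matpow l A m i j * A j k)"
    by (simp add: sum_distrib_left mult.assoc)
  also have "\<dots> = (\<Sum>j<l. (\<Sum>i<l. b i * matpow l A m i j) * A j k)"
    by (subst sum.swap) (simp add: sum_distrib_right)
  also have "\<dots> = \<gamma> ^ m * (\<Sum>j<l. b j * A j k)" by (simp add: Suc.IH sum_distrib_left mult.assoc)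
  finally show ?case using assms(1) Suc.prems by simp
qed

text \<open>Some power of \<open>A\<close> is entrywise positive and still has \<open>b\<close> as
  left eigenvector, so the previous estimate applies along the multiples of that exponent.\<close>

lemma positively_regular_negative_iterate:
  assumes reg: "positively_regular l A" and l: "l > 0" and \<rho>: "\<rho> > 0"
    and b_nonneg: "\<And>k. k < l \<Longrightarrow> b k \<ge> 0" and b_sum: "(\<Sum>k<l. b k) = 1"
    and b_eigen: "\<And>k. k < l \<Longrightarrow> (\<Sum>i<l. b i * A i k) = \<rho> * b k"
    and neg: "(\<Sum>k<l. b k * v k) < 0"
  shows "\<exists>m. \<forall>i<l. (apply_mat l A ^^ m) v i < 0"
proof -
  from reg obtain m where m: "\<And>i k. i < l \<Longrightarrow> k < l \<Longrightarrow> matpow l A m i k > 0"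
    by (auto simp: positively_regular_def)
  have "\<exists>n. \<forall>i<l. (apply_mat l A ^^ (m * n)) v i < 0"
  proof (rule negative_iterate_of_positive_matrix[where A = "matpow l A m" and b = b and \<gamma> = "\<rho> ^ m"])
    show "(\<Sum>i<l. b i * matpow l A m i k) = \<rho> ^ m * b k" if "k < l" for k
      using that b_eigen by (intro matpow_left_eigen)
    show "(apply_mat l A ^^ (m * Suc n)) v i = (\<Sum>k<l. matpow l A m i k * (apply_mat l A ^^ (m * n)) v k)"
      if "i < l" for n i
      using funpow_apply_mat[OF that, where A = A and m = m] by (simp add: funpow_add apply_mat_def)
  qed (use assms m in auto)
  then show ?thesis by blast
qed

section \<open>Independent draws\<close>

lemma nn_integral_draw_all_sum_list:
  "(\<integral>\<^sup>+ ys. (\<Sum>y\<leftarrow>ys. f y) \<partial>measure_pmf (draw_all q xs)) =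
     (\<Sum>x\<leftarrow>xs. \<integral>\<^sup>+ y. f y \<partial>measure_pmf (q x))" for f :: "'b \<Rightarrow> ennreal"
  by (induction xs) (simp_all add: nn_integral_add measure_pmf.emeasure_space_1[simplified])

lemma set_pmf_draw_all:
  assumes "ys \<in> set_pmf (draw_all q xs)"
  shows "length ys = length xs" "y \<in> set ys \<Longrightarrow> \<exists>x\<in>set xs. y \<in> set_pmf (q x)"
  using assms by (induction xs arbitrary: ys) fastforce+

text \<open>Quantifying over the shift \<open>a\<close> encodes that the fluctuation is centred, so that bounds of this form
  compose along independent sums and along generations without a cross term.\<close>

lemma nn_integral_centred_square_le:
  fixes f :: "'a \<Rightarrow> real"
  assumes "(\<integral>\<^sup>+ y. ennreal ((f y)\<^sup>2) \<partial>measure_pmf q) \<le> ennreal c" and "c \<ge> 0"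
  shows "(\<integral>\<^sup>+ y. ennreal ((a + f y - measure_pmf.expectation q f)\<^sup>2) \<partial>measure_pmf q) \<le> ennreal (a\<^sup>2 + c)"
proof -
  have int2: "integrable (measure_pmf q) (\<lambda>y. (f y)\<^sup>2)"
    using assms by (intro integrableI_bounded) (auto intro: le_less_trans)
  have int: "integrable (measure_pmf q) f"
    by (rule measure_pmf.square_integrable_imp_integrable[OF _ int2]) simp
  define m where "m = measure_pmf.expectation q f"
  have second: "measure_pmf.expectation q (\<lambda>y. (f y)\<^sup>2) \<le> c"
    using assms int2 by (simp add: nn_integral_eq_integral)
  have expand: "(a + f y - m)\<^sup>2 = (f y)\<^sup>2 + 2 * (a - m) * f y + (a - m)\<^sup>2" for y
    by (simp add: power2_eq_square algebra_simps)
  have "measure_pmf.expectation q (\<lambda>y. (a + f y - m)\<^sup>2) =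
      measure_pmf.expectation q (\<lambda>y. (f y)\<^sup>2) + 2 * (a - m) * m + (a - m)\<^sup>2"
    unfolding expand using int int2 by (simp add: m_def)
  \<comment> \<open>The terms linear in \<open>a\<close> cancel, leaving \<open>a\<^sup>2\<close>
    plus the variance, which is at most the second moment.\<close>
  also have "\<dots> = a\<^sup>2 + (measure_pmf.expectation q (\<lambda>y. (f y)\<^sup>2) - m\<^sup>2)"
    by (simp add: power2_eq_square algebra_simps)
  also have "\<dots> \<le> a\<^sup>2 + c" using second zero_le_power2[of m] by linarith
  finally have "measure_pmf.expectation q (\<lambda>y. (a + f y - m)\<^sup>2) \<le> a\<^sup>2 + c" .
  moreover have "integrable (measure_pmf q) (\<lambda>y. (a + f y - m)\<^sup>2)"
    unfolding expand using int int2 by (intro Bochner_Integration.integrable_add integrable_mult_right) auto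
  ultimately show ?thesis by (simp add: m_def nn_integral_eq_integral ennreal_leI)
qed

text \<open>Additivity of variance: the centred value of the first draw is absorbed into the shift
  for the remaining draws, so each draw costs one \<open>c\<close>.\<close>

lemma nn_integral_draw_all_square_le:
  fixes f :: "'b \<Rightarrow> real"
  assumes "\<And>x a. x \<in> set xs \<Longrightarrow>
      (\<integral>\<^sup>+ y. ennreal ((a + f y - \<mu> x)\<^sup>2) \<partial>measure_pmf (q x)) \<le> ennreal (a\<^sup>2 + c)"
    and "c \<ge> 0"
  shows "(\<integral>\<^sup>+ ys. ennreal ((a + (\<Sum>y\<leftarrow>ys. f y) - (\<Sum>x\<leftarrow>xs. \<mu> x))\<^sup>2) \<partial>measure_pmf (draw_all q xs))
           \<le> ennreal (a\<^sup>2 + c * length xs)"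
  using assms(1)
proof (induction xs arbitrary: a)
  case (Cons x xs)
  have "(\<integral>\<^sup>+ ys. ennreal ((a + (\<Sum>y\<leftarrow>ys. f y) - (\<Sum>x\<leftarrow>x # xs. \<mu> x))\<^sup>2) \<partial>measure_pmf (draw_all q (x # xs)))
    = (\<integral>\<^sup>+ y. \<integral>\<^sup>+ ys. ennreal (((a + f y - \<mu> x) + (\<Sum>y\<leftarrow>ys. f y) - (\<Sum>x\<leftarrow>xs. \<mu> x))\<^sup>2)
        \<partial>measure_pmf (draw_all q xs) \<partial>measure_pmf (q x))"
    by (simp add: algebra_simps)
  also have "\<dots> \<le> (\<integral>\<^sup>+ y. ennreal ((a + f y - \<mu> x)\<^sup>2 + c * length xs) \<partial>measure_pmf (q x))"
    using Cons by (intro nn_integral_mono) auto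
  also have "\<dots> = (\<integral>\<^sup>+ y. ennreal ((a + f y - \<mu> x)\<^sup>2) \<partial>measure_pmf (q x)) + ennreal (c * length xs)"
    using assms(2) by (simp add: ennreal_plus nn_integral_add measure_pmf.emeasure_space_1[simplified] del: ennreal_plus[symmetric])
  also have "\<dots> \<le> ennreal (a\<^sup>2 + c) + ennreal (c * length xs)"
    using Cons.prems by (intro add_right_mono) auto
  also have "\<dots> = ennreal (a\<^sup>2 + c * length (x # xs))"
    using assms(2) by (subst ennreal_plus[symmetric]) (auto simp: algebra_simps)
  finally show ?case .
qed simp

text \<open>The inequality between harmonic and arithmetic means, a form of Cauchy-Schwarz. It
  bounds the reciprocal of a total family size by reciprocals of the single family sizes.\<close>

lemma length_square_le_sum_mult_sum_inverse:
  fixes xs :: "real list"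
  assumes "\<And>x. x \<in> set xs \<Longrightarrow> x > 0"
  shows "(real (length xs))\<^sup>2 \<le> (\<Sum>x\<leftarrow>xs. x) * (\<Sum>x\<leftarrow>xs. 1 / x)"
  using assms
proof (induction xs)
  case (Cons y xs)
  define S where "S = (\<Sum>x\<leftarrow>xs. x)"
  define R where "R = (\<Sum>x\<leftarrow>xs. 1 / x)"
  define n where "n = real (length xs)"
  have y: "y > 0" and IH: "n\<^sup>2 \<le> S * R" using Cons by (auto simp: S_def R_def n_def)
  have S: "S \<ge> 0" and R: "R \<ge> 0"
    unfolding S_def R_def using Cons.prems by (auto intro!: sum_list_nonneg simp: less_imp_le)
  \<comment> \<open>AM-GM for the two mixed terms \<open>S / y\<close> and \<open>y * R\<close>,
    whose product is \<open>S * R\<close>.\<close>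
  have "(2 * n)\<^sup>2 \<le> 4 * (S * R)" using IH by (simp add: power2_eq_square)
  also have "\<dots> \<le> (S / y + y * R)\<^sup>2"
    using zero_le_power2[of "S / y - y * R"] y by (simp add: power2_eq_square field_simps)
  finally have "2 * n \<le> S / y + y * R"
    using S R y by (intro power2_le_imp_le[of "2 * n"]) auto
  then have "(n + 1)\<^sup>2 \<le> S * R + (S / y + y * R) + 1"
    using IH by (simp add: power2_eq_square algebra_simps)
  also have "\<dots> = (y + S) * (1 / y + R)" using y by (simp add: field_simps)
  finally show ?case by (simp add: S_def R_def n_def add.commute)
qed simp

section \<open>Moments of the branching process\<close>

lemma sum_list_children:
  "(\<Sum>c\<leftarrow>children l Y. g c) = (\<Sum>k<l. real (Y k) * g (k, Y))" for g :: "_ \<Rightarrow> real"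
proof -
  have "(\<Sum>c\<leftarrow>concat (map (\<lambda>k. replicate (Y k) (k, Y)) ks). g c) = (\<Sum>k\<leftarrow>ks. real (Y k) * g (k, Y))" for ks
    by (induction ks) (simp_all add: sum_list_replicate)
  then show ?thesis
    by (simp add: children_def interv_sum_list_conv_sum_set_nat atLeast0LessThan)
qed

lemma length_children: "length (children l Y) = vnorm l Y"
  using sum_list_children[of "\<lambda>_. 1" l Y] by (simp add: vnorm_def sum_list_triv flip: of_nat_sum)

lemma fst_children: "c \<in> set (children l Y) \<Longrightarrow> fst c < l"
  by (auto simp: children_def)

lemma sum_list_concat_map:
  "(\<Sum>c\<leftarrow>concat (map h Ys). g c) = (\<Sum>Y\<leftarrow>Ys. \<Sum>c\<leftarrow>h Y. g c)" for g :: "_ \<Rightarrow> real"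
  by (induction Ys) simp_all

text \<open>Unrolled from the earliest generation, opposite to \<open>generation\<close>, so that
  inductions on the number of steps condition on the next generation first.\<close>

fun descendants :: "nat \<Rightarrow> (nat \<Rightarrow> (nat \<Rightarrow> nat) pmf) \<Rightarrow> nat \<Rightarrow>
    (nat \<times> (nat \<Rightarrow> nat)) list \<Rightarrow> (nat \<times> (nat \<Rightarrow> nat)) list pmf" where
  "descendants l p 0 xs = return_pmf xs"
| "descendants l p (Suc m) xs = bind_pmf (next_gen l p xs) (descendants l p m)"

text \<open>The Markov property at generation \<open>n\<close>.\<close>

lemma generation_add: "generation l p i0 (n + m) = bind_pmf (generation l p i0 n) (descendants l p m)"
proof (induction m arbitrary: n)
  case 0
  show ?case by (simp add: bind_return_pmf' cong: bind_pmf_cong)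
next
  case (Suc m)
  have "generation l p i0 (n + Suc m) = generation l p i0 (Suc n + m)" by simp
  also have "\<dots> = bind_pmf (generation l p i0 n) (descendants l p (Suc m))"
    unfolding Suc.IH by (simp add: bind_assoc_pmf fun_eq_iff cong: bind_pmf_cong)
  finally show ?case .
qed

section \<open>Conditional means and second moments along the generations\<close>

locale galton_watson =
  fixes l :: nat and p :: "nat \<Rightarrow> (nat \<Rightarrow> nat) pmf" and C :: real
  assumes C_nonneg: "C \<ge> 0"
    and second_moment:
      "\<And>i. i < l \<Longrightarrow> (\<integral>\<^sup>+ u. ennreal ((real (vnorm l u))\<^sup>2) \<partial>measure_pmf (p i)) \<le> ennreal C"
    and vnorm_pos: "\<And>i u. i < l \<Longrightarrow> u \<in> set_pmf (p i) \<Longrightarrow> vnorm l u \<ge> 1"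
begin

definition well_typed :: "(nat \<times> (nat \<Rightarrow> nat)) list \<Rightarrow> bool" where
  "well_typed xs \<longleftrightarrow> (\<forall>x\<in>set xs. fst x < l)"

definition offspring_mean :: "(nat \<times> (nat \<Rightarrow> nat) \<Rightarrow> real) \<Rightarrow> nat \<Rightarrow> real" where
  "offspring_mean g i = measure_pmf.expectation (p i) (\<lambda>Y. \<Sum>c\<leftarrow>children l Y. g c)"

lemma well_typed_next_gen: "ys \<in> set_pmf (next_gen l p xs) \<Longrightarrow> well_typed ys"
  unfolding well_typed_def next_gen_def using fst_children by fastforce

lemma length_next_gen:
  assumes "well_typed xs" "ys \<in> set_pmf (next_gen l p xs)"
  shows "length xs \<le> length ys"
proof -
  from assms(2) obtain Ys where Ys: "Ys \<in> set_pmf (draw_all (\<lambda>x. p (fst x)) xs)"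
    and ys: "ys = concat (map (children l) Ys)"
    by (auto simp: next_gen_def)
  have "\<forall>Y\<in>set Ys. 1 \<le> vnorm l Y"
    using set_pmf_draw_all(2)[OF Ys] assms(1) vnorm_pos by (fastforce simp: well_typed_def)
  then have "(\<Sum>Y\<leftarrow>Ys. 1) \<le> (\<Sum>Y\<leftarrow>Ys. vnorm l Y)" by (intro sum_list_mono) auto
  then show ?thesis
    using set_pmf_draw_all(1)[OF Ys]
    by (simp add: ys length_concat length_children comp_def sum_list_triv)
qed

lemma generation_nonempty:
  assumes "i0 < l" "xs \<in> set_pmf (generation l p i0 n)"
  shows "well_typed xs" "length xs \<ge> 1"
proof -
  have "well_typed xs \<and> length xs \<ge> 1"
    using assms(2)
  proof (induction n arbitrary: xs)
    case 0
    then show ?case using assms(1) by (simp add: well_typed_def)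
  next
    case (Suc n)
    then show ?case using well_typed_next_gen length_next_gen by fastforce
  qed
  then show "well_typed xs" "length xs \<ge> 1" by auto
qed

lemma nn_integral_children_square_le:
  assumes i: "i < l" and g: "\<forall>c. fst c < l \<longrightarrow> \<bar>g c\<bar> \<le> B"
  shows "(\<integral>\<^sup>+ Y. ennreal ((\<Sum>c\<leftarrow>children l Y. g c)\<^sup>2) \<partial>measure_pmf (p i)) \<le> ennreal (C * B\<^sup>2)"
proof -
  have bound: "(\<Sum>c\<leftarrow>children l Y. g c)\<^sup>2 \<le> B\<^sup>2 * (real (vnorm l Y))\<^sup>2" for Y
  proof -
    have "\<bar>\<Sum>c\<leftarrow>children l Y. g c\<bar> \<le> (\<Sum>k<l. real (Y k) * B)"
      unfolding sum_list_children using g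
      by (intro order.trans[OF sum_abs] sum_mono) (auto simp: abs_mult intro!: mult_left_mono)
    also have "\<dots> = B * real (vnorm l Y)" by (simp add: vnorm_def sum_distrib_left mult.commute)
    finally show ?thesis
      using power_mono[of "\<bar>\<Sum>c\<leftarrow>children l Y. g c\<bar>" _ 2] by (fastforce simp: power_mult_distrib)
  qed
  have "(\<integral>\<^sup>+ Y. ennreal ((\<Sum>c\<leftarrow>children l Y. g c)\<^sup>2) \<partial>measure_pmf (p i))
      \<le> (\<integral>\<^sup>+ Y. ennreal (B\<^sup>2) * ennreal ((real (vnorm l Y))\<^sup>2) \<partial>measure_pmf (p i))"
    using bound by (intro nn_integral_mono) (auto simp: ennreal_mult[symmetric] intro!: ennreal_leI)
  also have "\<dots> \<le> ennreal (B\<^sup>2) * ennreal C"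
    using second_moment[OF i] by (simp add: nn_integral_cmult mult_left_mono)
  finally show ?thesis
    using C_nonneg by (simp add: ennreal_mult[symmetric] mult.commute)
qed

lemma integrable_children:
  assumes "i < l" and "\<forall>c. fst c < l \<longrightarrow> \<bar>g c\<bar> \<le> (B :: real)"
  shows "integrable (measure_pmf (p i)) (\<lambda>Y. \<Sum>c\<leftarrow>children l Y. g c)"
proof (rule measure_pmf.square_integrable_imp_integrable)
  show "integrable (measure_pmf (p i)) (\<lambda>Y. (\<Sum>c\<leftarrow>children l Y. g c)\<^sup>2)"
    using nn_integral_children_square_le[OF assms]
    by (intro integrableI_bounded) (auto intro: le_less_trans)
qed simp

lemma next_gen_square_le:
  assumes xs: "well_typed xs" and g: "\<forall>c. fst c < l \<longrightarrow> \<bar>g c\<bar> \<le> B"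
  shows "(\<integral>\<^sup>+ ys. ennreal ((a + (\<Sum>c\<leftarrow>ys. g c) - (\<Sum>x\<leftarrow>xs. offspring_mean g (fst x)))\<^sup>2)
            \<partial>measure_pmf (next_gen l p xs)) \<le> ennreal (a\<^sup>2 + C * B\<^sup>2 * length xs)"
proof -
  have single: "(\<integral>\<^sup>+ Y. ennreal ((a + (\<Sum>c\<leftarrow>children l Y. g c) - offspring_mean g i)\<^sup>2)
      \<partial>measure_pmf (p i)) \<le> ennreal (a\<^sup>2 + C * B\<^sup>2)" if i: "i < l" for a i
    unfolding offspring_mean_def
    using i g C_nonneg by (intro nn_integral_centred_square_le nn_integral_children_square_le) auto
  show ?thesis
    unfolding next_gen_def nn_integral_map_pmf sum_list_concat_map
    using xs C_nonneg by (intro nn_integral_draw_all_square_le single) (auto simp: well_typed_def)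
qed

lemma nn_integral_length_next_gen_le:
  assumes "well_typed xs"
  shows "(\<integral>\<^sup>+ ys. ennreal (length ys) \<partial>measure_pmf (next_gen l p xs)) \<le> ennreal (C * length xs)"
proof -
  have "(\<integral>\<^sup>+ u. ennreal (vnorm l u) \<partial>measure_pmf (p i)) \<le> ennreal C" if "i < l" for i
  proof -
    have "(\<integral>\<^sup>+ u. ennreal (vnorm l u) \<partial>measure_pmf (p i))
        \<le> (\<integral>\<^sup>+ u. ennreal ((real (vnorm l u))\<^sup>2) \<partial>measure_pmf (p i))"
    proof (intro nn_integral_mono ennreal_leI)
      fix u
      have "vnorm l u \<le> (vnorm l u)\<^sup>2" by (simp add: power2_eq_square)
      then show "real (vnorm l u) \<le> (real (vnorm l u))\<^sup>2" by (metis of_nat_le_iff of_nat_power)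
    qed
    then show ?thesis using second_moment[OF that] by simp
  qed
  then have le: "(\<Sum>x\<leftarrow>xs. \<integral>\<^sup>+ u. ennreal (vnorm l u) \<partial>measure_pmf (p (fst x))) \<le> (\<Sum>x\<leftarrow>xs. ennreal C)"
    using assms by (intro sum_list_mono) (auto simp: well_typed_def)
  have len: "ennreal (length (concat (map (children l) Ys))) = (\<Sum>Y\<leftarrow>Ys. ennreal (vnorm l Y))" for Ys
    by (induction Ys) (simp_all add: length_children ennreal_plus del: ennreal_plus[symmetric])
  have "(\<Sum>x\<leftarrow>xs. ennreal C) = ennreal (C * length xs)"
    using C_nonneg by (induction xs) (simp_all add: algebra_simps flip: ennreal_plus)
  then show ?thesis
    unfolding next_gen_def nn_integral_map_pmf len nn_integral_draw_all_sum_list using le by simp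
qed

text \<open>For functions of the type alone, averaging over one generation is the mean matrix. This
  is why only the first averaging step sees labels and all earlier ones are powers of
  \<open>M\<close>.\<close>

lemma offspring_mean_type:
  assumes i: "i < l"
  shows "offspring_mean (\<lambda>c. v (fst c)) i = apply_mat l (mean_matrix p) v i"
proof -
  have int: "integrable (measure_pmf (p i)) (\<lambda>u. real (u k))" if k: "k < l" for k
  proof -
    \<comment> \<open>A coordinate of \<open>Y\<close> is the number of children of type
      \<open>k\<close>, so integrability follows from the bound for bounded functions.\<close>
    have "(\<Sum>c\<leftarrow>children l Y. if fst c = k then 1 else 0) = real (Y k)" for Y
      using k by (simp add: sum_list_children if_distrib cong: if_cong)
    then show ?thesis
      using integrable_children[OF i, of "\<lambda>c. if fst c = k then 1 else 0" 1] by simp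
  qed
  show ?thesis
    unfolding offspring_mean_def apply_mat_def mean_matrix_def sum_list_children
    by (subst Bochner_Integration.integral_sum) (auto intro!: integrable_mult_left int)
qed

text \<open>Law of total variance, iterated over \<open>m + 1\<close> generations. The constant may
  depend on \<open>m\<close> and \<open>g\<close> but not on the starting population, so the
  variance is linear in its size.\<close>

lemma descendants_square_le:
  assumes g: "\<forall>c. fst c < l \<longrightarrow> \<bar>g c\<bar> \<le> B"
  shows "\<exists>c\<ge>0::real. \<forall>xs a. well_typed xs \<longrightarrow>
     (\<integral>\<^sup>+ ys. ennreal ((a + (\<Sum>c\<leftarrow>ys. g c)
         - (\<Sum>x\<leftarrow>xs. (apply_mat l (mean_matrix p) ^^ m) (offspring_mean g) (fst x)))\<^sup>2)
       \<partial>measure_pmf (descendants l p (Suc m) xs)) \<le> ennreal (a\<^sup>2 + c * length xs)"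
proof (induction m)
  case 0
  have "descendants l p (Suc 0) xs = next_gen l p xs" for xs
    by (simp add: bind_return_pmf' cong: bind_pmf_cong)
  then show ?case
    using next_gen_square_le[OF _ g] C_nonneg by (intro exI[of _ "C * B\<^sup>2"]) auto
next
  case (Suc m)
  define v where "v = (apply_mat l (mean_matrix p) ^^ m) (offspring_mean g)"
  define w where "w = apply_mat l (mean_matrix p) v"
  define B' where "B' = (\<Sum>k<l. \<bar>v k\<bar>)"
  have B': "\<bar>v k\<bar> \<le> B'" if "k < l" for k
    unfolding B'_def using that by (intro member_le_sum) auto
  from Suc obtain c :: real where c: "c \<ge> 0" and IH: "\<And>xs a. well_typed xs \<Longrightarrow>
     (\<integral>\<^sup>+ ys. ennreal ((a + (\<Sum>c\<leftarrow>ys. g c) - (\<Sum>x\<leftarrow>xs. v (fst x)))\<^sup>2)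
       \<partial>measure_pmf (descendants l p (Suc m) xs)) \<le> ennreal (a\<^sup>2 + c * length xs)"
    unfolding v_def by blast
  show ?case
  \<comment> \<open>\<open>C * B'\<^sup>2\<close> comes from the fluctuation of \<open>v\<close>
    over the first step; \<open>c * C\<close> is the later fluctuation, with the expected size of
    the next generation at most \<open>C * length xs\<close>.\<close>
  proof (intro exI[of _ "C * B'\<^sup>2 + c * C"] conjI allI impI)
    show "C * B'\<^sup>2 + c * C \<ge> 0" using C_nonneg c by simp
    fix xs a
    assume xs: "well_typed xs"
    have mean_w: "(\<Sum>x\<leftarrow>xs. offspring_mean (\<lambda>c. v (fst c)) (fst x)) = (\<Sum>x\<leftarrow>xs. w (fst x))"
      using xs unfolding w_def well_typed_def
      by (intro arg_cong[of _ _ sum_list] map_cong refl offspring_mean_type) auto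
    \<comment> \<open>The conditional mean given the next generation \<open>zs\<close> is added and
      subtracted; its deviation from the overall mean becomes the shift in
      \<open>IH\<close>.\<close>
    have "(\<integral>\<^sup>+ ys. ennreal ((a + (\<Sum>c\<leftarrow>ys. g c) - (\<Sum>x\<leftarrow>xs. w (fst x)))\<^sup>2)
           \<partial>measure_pmf (descendants l p (Suc (Suc m)) xs))
        = (\<integral>\<^sup>+ zs. \<integral>\<^sup>+ ys. ennreal (((a + (\<Sum>z\<leftarrow>zs. v (fst z)) - (\<Sum>x\<leftarrow>xs. w (fst x)))
             + (\<Sum>c\<leftarrow>ys. g c) - (\<Sum>z\<leftarrow>zs. v (fst z)))\<^sup>2)
           \<partial>measure_pmf (descendants l p (Suc m) zs) \<partial>measure_pmf (next_gen l p xs))"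
      unfolding descendants.simps(2)[of l p "Suc m"] nn_integral_bind_pmf
      by (simp add: algebra_simps del: descendants.simps)
    also have "\<dots> \<le> (\<integral>\<^sup>+ zs. ennreal ((a + (\<Sum>z\<leftarrow>zs. v (fst z)) - (\<Sum>x\<leftarrow>xs. w (fst x)))\<^sup>2
             + c * length zs) \<partial>measure_pmf (next_gen l p xs))"
      by (intro nn_integral_mono_AE AE_pmfI IH well_typed_next_gen)
    also have "\<dots> = (\<integral>\<^sup>+ zs. ennreal ((a + (\<Sum>z\<leftarrow>zs. v (fst z)) - (\<Sum>x\<leftarrow>xs. w (fst x)))\<^sup>2)
             \<partial>measure_pmf (next_gen l p xs))
          + ennreal c * (\<integral>\<^sup>+ zs. ennreal (length zs) \<partial>measure_pmf (next_gen l p xs))"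
      using c by (simp add: nn_integral_add nn_integral_cmult ennreal_mult ennreal_plus del: ennreal_plus[symmetric])
    also have "\<dots> \<le> ennreal (a\<^sup>2 + C * B'\<^sup>2 * length xs) + ennreal c * ennreal (C * length xs)"
      using next_gen_square_le[OF xs, of "\<lambda>c. v (fst c)" B' a] B' nn_integral_length_next_gen_le[OF xs]
      by (intro add_mono mult_left_mono) (auto simp: mean_w)
    also have "\<dots> = ennreal (a\<^sup>2 + (C * B'\<^sup>2 + c * C) * length xs)"
      using c C_nonneg by (simp add: algebra_simps flip: ennreal_mult ennreal_plus)
    finally show "(\<integral>\<^sup>+ ys. ennreal ((a + (\<Sum>c\<leftarrow>ys. g c)
         - (\<Sum>x\<leftarrow>xs. (apply_mat l (mean_matrix p) ^^ Suc m) (offspring_mean g) (fst x)))\<^sup>2)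
       \<partial>measure_pmf (descendants l p (Suc (Suc m)) xs)) \<le> ennreal (a\<^sup>2 + (C * B'\<^sup>2 + c * C) * length xs)"
      by (simp add: w_def v_def)
  qed
qed

text \<open>Source of the size bias: an offspring vector \<open>u\<close> is reported once by each
  of its \<open>vnorm l u\<close> children. The constant \<beta> picks up the mean family
  size.\<close>

lemma offspring_mean_label:
  assumes i: "i < l"
  shows "offspring_mean (\<lambda>c. (if snd c = u then \<alpha> else 0) + \<beta>) i =
           \<alpha> * vnorm l u * pmf (p i) u + \<beta> * (\<Sum>k<l. mean_matrix p i k)"
proof -
  let ?g = "\<lambda>c. if snd c = u then \<alpha> else 0"
  have "(\<Sum>c\<leftarrow>children l Y. ?g c) = \<alpha> * vnorm l u * indicator {u} Y" for Y
    by (simp add: sum_list_children vnorm_def indicator_def sum_distrib_left mult.commute)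
  then have "offspring_mean ?g i = \<alpha> * vnorm l u * pmf (p i) u"
    by (simp add: offspring_mean_def measure_pmf_single)
  moreover have "offspring_mean (\<lambda>_. \<beta>) i = \<beta> * (\<Sum>k<l. mean_matrix p i k)"
    using offspring_mean_type[OF i, of "\<lambda>_. \<beta>"] by (simp add: apply_mat_def sum_distrib_left mult.commute)
  moreover have "offspring_mean (\<lambda>c. ?g c + \<beta>) i = offspring_mean ?g i + offspring_mean (\<lambda>_. \<beta>) i"
    unfolding offspring_mean_def sum_list_addf
    using i by (intro Bochner_Integration.integral_add integrable_children[where B = "\<bar>\<alpha>\<bar>"]
        integrable_children[where B = "\<bar>\<beta>\<bar>"]) auto
  ultimately show ?thesis by simp
qed

section \<open>Geometric decay of the mean reciprocal population size\<close>

lemma inverse_length_next_gen_le: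
  assumes \<kappa>: "\<And>i. i < l \<Longrightarrow> (\<integral>\<^sup>+ u. ennreal (1 / vnorm l u) \<partial>measure_pmf (p i)) \<le> ennreal \<kappa>" "\<kappa> \<ge> 0"
    and xs: "well_typed xs" "length xs \<ge> 1"
  shows "(\<integral>\<^sup>+ ys. ennreal (1 / length ys) \<partial>measure_pmf (next_gen l p xs)) \<le> ennreal (\<kappa> * (1 / length xs))"
proof -
  define n where "n = real (length xs)"
  have n: "n > 0" using xs(2) unfolding n_def by linarith
  have sum_ennreal: "(\<Sum>Y\<leftarrow>Ys. ennreal (f Y)) = ennreal (\<Sum>Y\<leftarrow>Ys. f Y)"
    if "\<And>Y. f Y \<ge> 0" for Ys :: "'z list" and f
    using that by (induction Ys) (auto intro!: ennreal_plus[symmetric] sum_list_nonneg)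
  \<comment> \<open>Harmonic-arithmetic mean inequality: a factor \<open>1 / n\<^sup>2\<close> in
    front of a sum of \<open>n\<close> reciprocals, each of mean at most \<kappa>, leaves \<kappa>
    divided by \<open>n\<close>.\<close>
  have pointwise: "ennreal (1 / length (concat (map (children l) Ys)))
      \<le> ennreal (1 / n\<^sup>2) * (\<Sum>Y\<leftarrow>Ys. ennreal (1 / vnorm l Y))"
    if Ys: "Ys \<in> set_pmf (draw_all (\<lambda>x. p (fst x)) xs)" for Ys
  proof -
    have pos: "\<forall>Y\<in>set Ys. 1 \<le> vnorm l Y"
      using set_pmf_draw_all(2)[OF Ys] xs vnorm_pos by (fastforce simp: well_typed_def)
    define S where "S = (\<Sum>Y\<leftarrow>Ys. real (vnorm l Y))"
    have S: "real (length (concat (map (children l) Ys))) = S"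
      unfolding S_def by (induction Ys) (simp_all add: length_children)
    have "(\<Sum>Y\<leftarrow>Ys. 1) \<le> S"
      unfolding S_def using pos by (intro sum_list_mono) fastforce
    then have "n \<le> S" using set_pmf_draw_all(1)[OF Ys] by (simp add: n_def sum_list_triv)
    then have "S > 0" using n by linarith
    moreover have "n\<^sup>2 \<le> S * (\<Sum>Y\<leftarrow>Ys. 1 / vnorm l Y)"
      using length_square_le_sum_mult_sum_inverse[of "map (\<lambda>Y. real (vnorm l Y)) Ys"] pos
        set_pmf_draw_all(1)[OF Ys] by (fastforce simp: n_def S_def comp_def)
    ultimately have "1 / S \<le> 1 / n\<^sup>2 * (\<Sum>Y\<leftarrow>Ys. 1 / vnorm l Y)"
      using n by (simp add: field_simps)
    then show ?thesis
      unfolding S by (subst sum_ennreal, simp, subst ennreal_mult[symmetric]) (auto intro!: sum_list_nonneg ennreal_leI)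
  qed
  have "(\<integral>\<^sup>+ ys. ennreal (1 / length ys) \<partial>measure_pmf (next_gen l p xs))
      \<le> (\<integral>\<^sup>+ Ys. ennreal (1 / n\<^sup>2) * (\<Sum>Y\<leftarrow>Ys. ennreal (1 / vnorm l Y))
            \<partial>measure_pmf (draw_all (\<lambda>x. p (fst x)) xs))"
    unfolding next_gen_def nn_integral_map_pmf
    using pointwise by (intro nn_integral_mono_AE) (simp add: AE_measure_pmf_iff)
  also have "\<dots> = ennreal (1 / n\<^sup>2) * (\<Sum>x\<leftarrow>xs. \<integral>\<^sup>+ Y. ennreal (1 / vnorm l Y) \<partial>measure_pmf (p (fst x)))"
    unfolding nn_integral_draw_all_sum_list[symmetric] by (intro nn_integral_cmult) simp
  also have "\<dots> \<le> ennreal (1 / n\<^sup>2) * (\<Sum>x\<leftarrow>xs. ennreal \<kappa>)"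
    using \<kappa>(1) xs by (intro mult_left_mono sum_list_mono) (auto simp: well_typed_def)
  also have "\<dots> = ennreal (1 / n\<^sup>2) * ennreal (n * \<kappa>)"
    using \<kappa>(2) by (subst sum_ennreal) (auto simp: sum_list_triv n_def)
  also have "\<dots> = ennreal (\<kappa> * (1 / n))"
    using n \<kappa>(2) by (simp add: power2_eq_square flip: ennreal_mult)
  finally show ?thesis by (simp add: n_def)
qed

lemma inverse_length_generation_le:
  assumes \<kappa>: "\<And>i. i < l \<Longrightarrow> (\<integral>\<^sup>+ u. ennreal (1 / vnorm l u) \<partial>measure_pmf (p i)) \<le> ennreal \<kappa>" "\<kappa> \<ge> 0"
    and i0: "i0 < l"
  shows "(\<integral>\<^sup>+ xs. ennreal (1 / length xs) \<partial>measure_pmf (generation l p i0 n)) \<le> ennreal (\<kappa> ^ n)"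
proof (induction n)
  case (Suc n)
  have "(\<integral>\<^sup>+ xs. ennreal (1 / length xs) \<partial>measure_pmf (generation l p i0 (Suc n)))
      \<le> (\<integral>\<^sup>+ xs. ennreal \<kappa> * ennreal (1 / length xs) \<partial>measure_pmf (generation l p i0 n))"
    unfolding generation.simps nn_integral_bind_pmf
    using inverse_length_next_gen_le[OF \<kappa>] generation_nonempty[OF i0] \<kappa>(2)
    by (intro nn_integral_mono_AE) (simp add: AE_measure_pmf_iff flip: ennreal_mult)
  also have "\<dots> \<le> ennreal \<kappa> * ennreal (\<kappa> ^ n)"
    using Suc by (simp add: nn_integral_cmult mult_left_mono)
  finally show ?case using \<kappa>(2) by (simp flip: ennreal_mult)
qed simp

section \<open>Chebyshev bounds and populations that grow in probability\<close>

lemma descendants_nonneg_le: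
  assumes g: "\<forall>c. fst c < l \<longrightarrow> \<bar>g c\<bar> \<le> B"
    and neg: "\<forall>i<l. (apply_mat l (mean_matrix p) ^^ m) (offspring_mean g) i < 0"
  shows "\<exists>K\<ge>0. \<forall>xs. well_typed xs \<longrightarrow> length xs \<ge> 1 \<longrightarrow>
     emeasure (measure_pmf (descendants l p (Suc m) xs)) {ys. (\<Sum>c\<leftarrow>ys. g c) \<ge> 0} \<le> ennreal (K * (1 / length xs))"
proof -
  define v where "v = (apply_mat l (mean_matrix p) ^^ m) (offspring_mean g)"
  from descendants_square_le[OF g, where m = m] obtain c :: real where c: "c \<ge> 0"
    and bound: "\<And>xs a. well_typed xs \<Longrightarrow>
     (\<integral>\<^sup>+ ys. ennreal ((a + (\<Sum>c\<leftarrow>ys. g c) - (\<Sum>x\<leftarrow>xs. v (fst x)))\<^sup>2)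
       \<partial>measure_pmf (descendants l p (Suc m) xs)) \<le> ennreal (a\<^sup>2 + c * length xs)"
    unfolding v_def by blast
  \<comment> \<open>Finitely many types give a uniform negative margin; with no types at all any
    positive \<open>d\<close> works vacuously.\<close>
  obtain d where d: "d > 0" "\<And>i. i < l \<Longrightarrow> v i \<le> - d"
  proof (cases "l = 0")
    case False
    show ?thesis
    proof (intro that[of "- Max (v ` {..<l})"])
      have "Max (v ` {..<l}) < 0" using neg False by (subst Max_less_iff) (auto simp: v_def)
      then show "- Max (v ` {..<l}) > 0" by linarith
      show "v i \<le> - (- Max (v ` {..<l}))" if "i < l" for i
        unfolding minus_minus using that by (intro Max_ge) auto
    qed
  qed (use that[of 1] in auto)
  show ?thesis
  proof (intro exI[of _ "c / d\<^sup>2"] conjI allI impI)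
    show "c / d\<^sup>2 \<ge> 0" using c by simp
    fix xs
    assume xs: "well_typed xs" "length xs \<ge> 1"
    define n where "n = real (length xs)"
    have n: "n > 0" using xs(2) unfolding n_def by linarith
    have "(\<Sum>x\<leftarrow>xs. v (fst x)) \<le> (\<Sum>x\<leftarrow>xs. - d)"
      using xs d by (intro sum_list_mono) (auto simp: well_typed_def)
    then have drift: "(\<Sum>x\<leftarrow>xs. v (fst x)) \<le> - (n * d)" by (simp add: sum_list_triv n_def)
    \<comment> \<open>Chebyshev: a nonnegative sum deviates from its mean by at least
      \<open>n * d\<close>, while the variance is at most \<open>c * n\<close>.\<close>
    have "indicator {ys. (\<Sum>c\<leftarrow>ys. g c) \<ge> 0} ys
        \<le> ennreal (1 / (n * d)\<^sup>2) * ennreal ((0 + (\<Sum>c\<leftarrow>ys. g c) - (\<Sum>x\<leftarrow>xs. v (fst x)))\<^sup>2)" for ys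
    proof (cases "(\<Sum>c\<leftarrow>ys. g c) \<ge> 0")
      case True
      then have "(n * d)\<^sup>2 \<le> (0 + (\<Sum>c\<leftarrow>ys. g c) - (\<Sum>x\<leftarrow>xs. v (fst x)))\<^sup>2"
        using drift n d by (intro power_mono) auto
      then have "1 \<le> 1 / (n * d)\<^sup>2 * (0 + (\<Sum>c\<leftarrow>ys. g c) - (\<Sum>x\<leftarrow>xs. v (fst x)))\<^sup>2"
        using n d by (simp add: divide_simps)
      then show ?thesis using True by (simp flip: ennreal_mult add: ennreal_leI flip: ennreal_1)
    qed simp
    then have "(\<integral>\<^sup>+ ys. indicator {ys. (\<Sum>c\<leftarrow>ys. g c) \<ge> 0} ys \<partial>measure_pmf (descendants l p (Suc m) xs))
        \<le> (\<integral>\<^sup>+ ys. ennreal (1 / (n * d)\<^sup>2) * ennreal ((0 + (\<Sum>c\<leftarrow>ys. g c) - (\<Sum>x\<leftarrow>xs. v (fst x)))\<^sup>2)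
            \<partial>measure_pmf (descendants l p (Suc m) xs))"
      by (intro nn_integral_mono)
    also have "\<dots> \<le> ennreal (1 / (n * d)\<^sup>2) * ennreal (0\<^sup>2 + c * n)"
      using bound[OF xs(1), of 0] by (simp add: nn_integral_cmult mult_left_mono n_def del: descendants.simps)
    also have "\<dots> = ennreal (c / d\<^sup>2 * (1 / n))"
      using c n d by (simp add: power2_eq_square mult_ac flip: ennreal_mult)
    finally show "emeasure (measure_pmf (descendants l p (Suc m) xs)) {ys. (\<Sum>c\<leftarrow>ys. g c) \<ge> 0}
        \<le> ennreal (c / d\<^sup>2 * (1 / length xs))"
      by (simp add: n_def del: descendants.simps)
  qed
qed

text \<open>Conditioning on generation \<open>n\<close> leaves a failure probability of order
  \<open>1 / length xs\<close>, whose expectation is at most a multiple of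
  \<open>\<kappa> ^ n\<close>.\<close>

lemma generation_nonneg_tendsto_0:
  assumes g: "\<forall>c. fst c < l \<longrightarrow> \<bar>g c\<bar> \<le> B"
    and neg: "\<forall>i<l. (apply_mat l (mean_matrix p) ^^ m) (offspring_mean g) i < 0"
    and \<kappa>: "\<And>i. i < l \<Longrightarrow> (\<integral>\<^sup>+ u. ennreal (1 / vnorm l u) \<partial>measure_pmf (p i)) \<le> ennreal \<kappa>" "\<kappa> \<ge> 0" "\<kappa> < 1"
    and i0: "i0 < l"
  shows "(\<lambda>n. measure_pmf.prob (generation l p i0 n) {ys. (\<Sum>c\<leftarrow>ys. g c) \<ge> 0}) \<longlonglongrightarrow> 0"
proof -
  let ?A = "{ys. (\<Sum>c\<leftarrow>ys. g c) \<ge> 0}"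
  from descendants_nonneg_le[OF g neg] obtain K where K: "K \<ge> 0"
    and bound: "\<And>xs. well_typed xs \<Longrightarrow> length xs \<ge> 1 \<Longrightarrow>
      emeasure (measure_pmf (descendants l p (Suc m) xs)) ?A \<le> ennreal (K * (1 / length xs))"
    by blast
  have le: "measure_pmf.prob (generation l p i0 (n + Suc m)) ?A \<le> K * \<kappa> ^ n" for n
  proof -
    have "emeasure (measure_pmf (generation l p i0 (n + Suc m))) ?A
        \<le> (\<integral>\<^sup>+ xs. ennreal K * ennreal (1 / length xs) \<partial>measure_pmf (generation l p i0 n))"
      unfolding generation_add emeasure_bind_pmf
      using bound generation_nonempty[OF i0] K
      by (intro nn_integral_mono_AE) (simp add: AE_measure_pmf_iff flip: ennreal_mult)
    also have "\<dots> \<le> ennreal K * ennreal (\<kappa> ^ n)"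
      using inverse_length_generation_le[OF \<kappa>(1,2) i0, of n] by (simp add: nn_integral_cmult mult_left_mono)
    finally show ?thesis
      using K \<kappa>(2) by (simp add: measure_pmf.emeasure_eq_measure flip: ennreal_mult)
  qed
  have "(\<lambda>n. K * \<kappa> ^ n) \<longlonglongrightarrow> K * 0"
    using \<kappa> by (intro tendsto_intros LIMSEQ_realpow_zero) auto
  then have "(\<lambda>n. measure_pmf.prob (generation l p i0 (n + Suc m)) ?A) \<longlonglongrightarrow> 0"
    by (rule Lim_null_comparison[rotated, OF tendsto_eq_rhs]) (use le in auto)
  then show ?thesis by (rule LIMSEQ_offset)
qed

text \<open>Markov's inequality for the reciprocal population size.\<close>

lemma generation_length_le_tendsto_0:
  assumes \<kappa>: "\<And>i. i < l \<Longrightarrow> (\<integral>\<^sup>+ u. ennreal (1 / vnorm l u) \<partial>measure_pmf (p i)) \<le> ennreal \<kappa>" "\<kappa> \<ge> 0" "\<kappa> < 1"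
    and i0: "i0 < l"
  shows "(\<lambda>n. measure_pmf.prob (generation l p i0 n) {xs. length xs \<le> k}) \<longlonglongrightarrow> 0"
proof -
  have le: "measure_pmf.prob (generation l p i0 n) {xs. length xs \<le> k} \<le> k * \<kappa> ^ n" for n
  proof -
    have "indicator {xs. length xs \<le> k} xs \<le> ennreal k * ennreal (1 / length xs)"
      if "xs \<in> set_pmf (generation l p i0 n)" for xs
    proof (cases "length xs \<le> k")
      case True
      moreover have "real (length xs) > 0" using generation_nonempty(2)[OF i0 that] by linarith
      ultimately have "1 \<le> real k * (1 / length xs)" by (simp add: le_divide_eq)
      then show ?thesis using True by (simp flip: ennreal_mult add: ennreal_leI flip: ennreal_1)
    qed simp
    then have "(\<integral>\<^sup>+ xs. indicator {xs. length xs \<le> k} xs \<partial>measure_pmf (generation l p i0 n))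
        \<le> (\<integral>\<^sup>+ xs. ennreal k * ennreal (1 / length xs) \<partial>measure_pmf (generation l p i0 n))"
      by (intro nn_integral_mono_AE) (simp add: AE_measure_pmf_iff)
    also have "\<dots> \<le> ennreal k * ennreal (\<kappa> ^ n)"
      using inverse_length_generation_le[OF \<kappa>(1,2) i0, of n] by (simp add: nn_integral_cmult mult_left_mono)
    finally show ?thesis
      using \<kappa>(2) by (simp add: measure_pmf.emeasure_eq_measure flip: ennreal_mult)
  qed
  have "(\<lambda>n. k * \<kappa> ^ n) \<longlonglongrightarrow> real k * 0"
    using \<kappa> by (intro tendsto_intros LIMSEQ_realpow_zero) auto
  then show ?thesis
    by (rule Lim_null_comparison[rotated, OF tendsto_eq_rhs]) (use le in auto)
qed

end

section \<open>Convergence in probability as a filter limit\<close>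

text \<open>The properties whose failure probability vanishes form a filter, so convergence in
  probability inherits the limit rules for products and compositions. The laws \<open>D n\<close>
  need no common probability space.\<close>

definition whp :: "(nat \<Rightarrow> 'a pmf) \<Rightarrow> 'a filter" where
  "whp D = Abs_filter (\<lambda>Q. (\<lambda>n. measure_pmf.prob (D n) {x. \<not> Q x}) \<longlonglongrightarrow> 0)"

lemma eventually_whp:
  "eventually Q (whp D) \<longleftrightarrow> (\<lambda>n. measure_pmf.prob (D n) {x. \<not> Q x}) \<longlonglongrightarrow> 0"
  unfolding whp_def
proof (rule eventually_Abs_filter, rule is_filter.intro)
  fix P Q
  assume "(\<lambda>n. measure_pmf.prob (D n) {x. \<not> P x}) \<longlonglongrightarrow> 0"
    and "(\<lambda>n. measure_pmf.prob (D n) {x. \<not> Q x}) \<longlonglongrightarrow> 0"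
  then have "(\<lambda>n. measure_pmf.prob (D n) {x. \<not> P x} + measure_pmf.prob (D n) {x. \<not> Q x}) \<longlonglongrightarrow> 0"
    by (rule tendsto_add_zero)
  then show "(\<lambda>n. measure_pmf.prob (D n) {x. \<not> (P x \<and> Q x)}) \<longlonglongrightarrow> 0"
  proof (rule Lim_null_comparison[rotated])
    have "measure_pmf.prob (D n) {x. \<not> (P x \<and> Q x)}
        \<le> measure_pmf.prob (D n) {x. \<not> P x} + measure_pmf.prob (D n) {x. \<not> Q x}" for n
      by (rule order.trans[OF _ measure_Un_le]) (auto intro!: measure_pmf.finite_measure_mono)
    then show "\<forall>\<^sub>F n in sequentially. norm (measure_pmf.prob (D n) {x. \<not> (P x \<and> Q x)})
        \<le> measure_pmf.prob (D n) {x. \<not> P x} + measure_pmf.prob (D n) {x. \<not> Q x}" by simp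
  qed
next
  fix P Q :: "'a \<Rightarrow> bool"
  assume "\<forall>x. P x \<longrightarrow> Q x" "(\<lambda>n. measure_pmf.prob (D n) {x. \<not> P x}) \<longlonglongrightarrow> 0"
  then show "(\<lambda>n. measure_pmf.prob (D n) {x. \<not> Q x}) \<longlonglongrightarrow> 0"
    by (elim Lim_null_comparison[rotated]) (auto intro!: always_eventually measure_pmf.finite_measure_mono)
qed simp

text \<open>Bounded convergence in probability: off the bad event the error is below \<epsilon>/2,
  and on it at most \<open>1 + \<bar>c\<bar>\<close>.\<close>

lemma expectation_tendsto_whp:
  fixes f :: "'a \<Rightarrow> real"
  assumes lim: "(f \<longlongrightarrow> c) (whp D)" and f: "\<And>x. 0 \<le> f x" "\<And>x. f x \<le> 1"
  shows "(\<lambda>n. measure_pmf.expectation (D n) f) \<longlonglongrightarrow> c"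
proof (rule tendstoI)
  fix \<epsilon> :: real
  assume \<epsilon>: "\<epsilon> > 0"
  define bad where "bad = {x. \<not> dist (f x) c < \<epsilon> / 2}"
  have "(\<lambda>n. measure_pmf.prob (D n) bad) \<longlonglongrightarrow> 0"
    using tendstoD[OF lim, of "\<epsilon> / 2"] \<epsilon> unfolding eventually_whp bad_def by simp
  then have "(\<lambda>n. (1 + \<bar>c\<bar>) * measure_pmf.prob (D n) bad) \<longlonglongrightarrow> (1 + \<bar>c\<bar>) * 0"
    by (intro tendsto_intros)
  then have "\<forall>\<^sub>F n in sequentially. (1 + \<bar>c\<bar>) * measure_pmf.prob (D n) bad < \<epsilon> / 2"
    using \<epsilon> order_tendstoD(2)[of _ _ _ "\<epsilon> / 2"] by fastforce
  then show "\<forall>\<^sub>F n in sequentially. dist (measure_pmf.expectation (D n) f) c < \<epsilon>"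
  proof eventually_elim
    case (elim n)
    have int: "integrable (measure_pmf (D n)) f"
      using f by (intro measure_pmf.integrable_const_bound[where B = 1]) auto
    have int_bad: "integrable (measure_pmf (D n)) (indicator bad :: _ \<Rightarrow> real)"
      by (intro integrable_real_indicator) (auto simp: less_top[symmetric])
    have pointwise: "\<bar>f x - c\<bar> \<le> \<epsilon> / 2 + (1 + \<bar>c\<bar>) * indicator bad x" for x
      using f[of x] \<epsilon> by (auto simp: bad_def dist_real_def indicator_def)
    have "dist (measure_pmf.expectation (D n) f) c = \<bar>measure_pmf.expectation (D n) (\<lambda>x. f x - c)\<bar>"
      using int by (simp add: dist_real_def)
    also have "\<dots> \<le> measure_pmf.expectation (D n) (\<lambda>x. \<bar>f x - c\<bar>)"
      by (rule integral_abs_bound)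
    also have "\<dots> \<le> measure_pmf.expectation (D n) (\<lambda>x. \<epsilon> / 2 + (1 + \<bar>c\<bar>) * indicator bad x)"
      using pointwise int int_bad by (intro integral_mono) auto
    also have "\<dots> = \<epsilon> / 2 + (1 + \<bar>c\<bar>) * measure_pmf.prob (D n) bad"
      using int_bad by (subst Bochner_Integration.integral_add) auto
    finally show ?case using elim by simp
  qed
qed

section \<open>Sampling without replacement\<close>

text \<open>Sampling with replacement: the positions are chosen independently, so the count of
  matching index lists factorizes.\<close>

lemma card_matching_lists:
  "card {is. list_all2 (\<lambda>i u. i < length xs \<and> f (xs ! i) = u) is us} =
     (\<Prod>u\<leftarrow>us. length (filter (\<lambda>x. f x = u) xs))"
proof (induction us)
  case Nil
  have "{is :: nat list. is = []} = {[]}" by auto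
  then show ?case by simp
next
  case (Cons u us)
  let ?M = "\<lambda>us. {is. list_all2 (\<lambda>i u. i < length xs \<and> f (xs ! i) = u) is us}"
  have "?M (u # us) = (\<lambda>(i, is). i # is) ` ({i. i < length xs \<and> f (xs ! i) = u} \<times> ?M us)"
    by (auto simp: list_all2_Cons2 image_iff)
  also have "card \<dots> = card {i. i < length xs \<and> f (xs ! i) = u} * card (?M us)"
    by (subst card_image) (auto simp: inj_on_def card_cartesian_product)
  finally show ?case by (simp add: Cons.IH length_filter_conv_card)
qed

text \<open>Total variation bound between the uniform laws on \<open>S\<close> and on
  \<open>T\<close>: they differ by at most the fraction of \<open>T\<close> lying outside
  \<open>S\<close>.\<close>

lemma restriction_ratio_le:
  assumes "finite T" "S \<subseteq> T" "M \<subseteq> T" "S \<noteq> {}"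
  shows "\<bar>real (card (S \<inter> M)) / card S - real (card M) / card T\<bar> \<le> 1 - real (card S) / card T"
proof -
  have fin: "finite S" "finite M" using assms finite_subset by blast+
  define A where "A = real (card (S \<inter> M))"
  define A' where "A' = real (card M)"
  define B where "B = real (card S)"
  define B' where "B' = real (card T)"
  have B: "B > 0" "B \<le> B'" using assms fin by (auto simp: B_def B'_def card_gt_0_iff card_mono)
  have A: "0 \<le> A" "A \<le> B" "A \<le> A'" using fin by (auto simp: A_def A'_def B_def intro!: card_mono)
  have "M \<subseteq> (S \<inter> M) \<union> (T - S)" using assms by blast
  then have "card M \<le> card (S \<inter> M) + card (T - S)"
    using assms fin by (intro order.trans[OF card_mono card_Un_le]) auto
  also have "card (T - S) = card T - card S" using assms fin by (simp add: card_Diff_subset)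
  finally have A': "A' \<le> A + (B' - B)"
    using card_mono[OF assms(1,2)] unfolding A_def A'_def B_def B'_def by linarith
  have "A / B - A' / B' \<le> A / B - A / B'" using A B by (simp add: divide_right_mono)
  also have "\<dots> = A / B * (1 - B / B')" using B by (simp add: field_simps)
  also have "\<dots> \<le> 1 * (1 - B / B')" using A B by (intro mult_right_mono) auto
  finally have upper: "A / B - A' / B' \<le> 1 - B / B'" by simp
  have "A' / B' - A / B \<le> A' / B' - A / B'" using A B by (simp add: frac_le)
  also have "\<dots> = (A' - A) / B'" by (simp add: diff_divide_distrib)
  also have "\<dots> \<le> (B' - B) / B'" using A' B by (intro divide_right_mono) auto
  also have "\<dots> = 1 - B / B'" using B by (simp add: field_simps)
  finally show ?thesis using upper by (simp add: A_def A'_def B_def B'_def)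
qed

text \<open>The number of distinct index lists is a falling factorial, with \<open>r\<close> factors
  each at least \<open>n - r\<close>.\<close>

lemma distinct_lists_ratio_ge:
  assumes "r \<le> n" "n > 0"
  shows "real (card {is. distinct is \<and> length is = r \<and> set is \<subseteq> {..<n}}) / real n ^ r \<ge> (1 - r / n) ^ r"
proof -
  have eq: "{is. distinct is \<and> length is = r \<and> set is \<subseteq> {..<n}} = {is. length is = r \<and> distinct is \<and> set is \<subseteq> {..<n}}"
    by auto
  have "(n - r) ^ r = (\<Prod>i\<in>{n - r + 1..n}. n - r)" using assms by simp
  also have "\<dots> \<le> \<Prod>{n - r + 1..n}" by (intro prod_mono) auto
  finally have "(n - r) ^ r \<le> card {is. distinct is \<and> length is = r \<and> set is \<subseteq> {..<n}}"
    unfolding eq using assms by (subst card_lists_distinct_length_eq) auto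
  then have "real (n - r) ^ r / real n ^ r \<le> real (card {is. distinct is \<and> length is = r \<and> set is \<subseteq> {..<n}}) / real n ^ r"
    by (intro divide_right_mono) (auto simp flip: of_nat_power)
  moreover have "real (n - r) / n = 1 - r / n" using assms by (simp add: of_nat_diff diff_divide_distrib)
  ultimately show ?thesis by (simp flip: power_divide)
qed

lemma measure_bind_pmf_eq_expectation:
  "measure_pmf.prob (bind_pmf D K) A = measure_pmf.expectation D (\<lambda>x. measure_pmf.prob (K x) A)"
proof -
  have "ennreal (measure_pmf.prob (bind_pmf D K) A) = (\<integral>\<^sup>+ x. ennreal (measure_pmf.prob (K x) A) \<partial>measure_pmf D)"
    by (simp flip: measure_pmf.emeasure_eq_measure)
  also have "\<dots> = ennreal (measure_pmf.expectation D (\<lambda>x. measure_pmf.prob (K x) A))"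
    by (intro nn_integral_eq_integral measure_pmf.integrable_const_bound[where B = 1]) auto
  finally show ?thesis by (simp add: integral_nonneg)
qed

text \<open>The conditional probability of the prescribed reports given the generation
  \<open>xs\<close>. The targets are indexed from 1, and the value 0 corresponds to the outcome
  \<open>None\<close> of \<open>sample_reports\<close>.\<close>

definition matching_prob :: "nat \<Rightarrow> (nat \<Rightarrow> 'b) \<Rightarrow> ('a \<times> 'b) list \<Rightarrow> real" where
  "matching_prob r us xs = (if r \<le> length xs then
     measure_pmf.prob (pmf_of_set {is. distinct is \<and> length is = r \<and> set is \<subseteq> {..<length xs}})
       {is. list_all2 (\<lambda>i u. i < length xs \<and> snd (xs ! i) = u) is (map us [1..<Suc r])} else 0)"

lemma distinct_index_lists:
  fixes r n :: nat
  defines "S \<equiv> {is. distinct is \<and> length is = r \<and> set is \<subseteq> {..<n}}"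
  shows "S \<subseteq> {is. set is \<subseteq> {..<n} \<and> length is = r}" "finite S" "r \<le> n \<Longrightarrow> S \<noteq> {}"
proof -
  show sub: "S \<subseteq> {is. set is \<subseteq> {..<n} \<and> length is = r}" by (auto simp: S_def)
  show "finite S" by (rule finite_subset[OF sub finite_lists_length_eq]) simp
  have "[0..<r] \<in> S" if "r \<le> n" using that by (auto simp: S_def)
  then show "r \<le> n \<Longrightarrow> S \<noteq> {}" by blast
qed

lemma prob_sample_reports:
  "measure_pmf.prob (sample_reports l p i0 r n)
      {ob. \<exists>xs. ob = Some xs \<and> (\<forall>w\<in>{1..r}. xs ! (w - 1) = us w)} =
   measure_pmf.expectation (generation l p i0 n) (matching_prob r us)"
  unfolding sample_reports_def measure_bind_pmf_eq_expectation
proof (rule Bochner_Integration.integral_cong[OF refl])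
  fix xs :: "(nat \<times> (nat \<Rightarrow> nat)) list"
  let ?A = "{ob. \<exists>xs. ob = Some xs \<and> (\<forall>w\<in>{1..r}. xs ! (w - 1) = us w)}"
  let ?S = "{is. distinct is \<and> length is = r \<and> set is \<subseteq> {..<length xs}}"
  let ?M = "{is. list_all2 (\<lambda>i u. i < length xs \<and> snd (xs ! i) = u) is (map us [1..<Suc r])}"
  let ?h = "\<lambda>is. Some (map (\<lambda>j. snd (xs ! j)) is)"
  show "measure_pmf.prob (if r \<le> length xs then map_pmf ?h (pmf_of_set ?S) else return_pmf None) ?A
      = matching_prob r us xs"
  proof (cases "r \<le> length xs")
    case True
    have "is \<in> ?h -` ?A \<longleftrightarrow> is \<in> ?M" if "is \<in> ?S" for "is"
    proof -
      have len: "length is = r" and bound: "\<And>i. i < r \<Longrightarrow> is ! i < length xs"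
        using that nth_mem by fastforce+
      \<comment> \<open>Translates the 1-based report index into 0-based list positions.\<close>
      have "{1..r} = Suc ` {..<r}" by (simp add: image_Suc_lessThan)
      then have "is \<in> ?h -` ?A \<longleftrightarrow> (\<forall>i<r. snd (xs ! (is ! i)) = us (Suc i))"
        using len by auto
      also have "\<dots> \<longleftrightarrow> is \<in> ?M"
        using len bound by (auto simp: list_all2_conv_all_nth simp del: upt_Suc)
      finally show ?thesis .
    qed
    then have "?S \<inter> ?h -` ?A = ?S \<inter> ?M" by blast
    then show ?thesis
      using True distinct_index_lists[of r "length xs"]
      by (simp add: matching_prob_def measure_pmf_of_set measure_map_pmf)
  next
    case False
    then show ?thesis by (simp add: matching_prob_def)
  qed
qed

text \<open>Compares distinct index lists with all index lists of length \<open>r\<close>, where the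
  probability is the product of label proportions. The error depends on \<open>xs\<close> only
  through its length.\<close>

lemma matching_prob_approx:
  assumes "r \<le> length xs" "xs \<noteq> []"
  shows "\<bar>matching_prob r us xs - (\<Prod>w=1..r. length (filter (\<lambda>x. snd x = us w) xs) / length xs)\<bar>
           \<le> 1 - (1 - r / length xs) ^ r"
proof -
  define n where "n = length xs"
  let ?S = "{is. distinct is \<and> length is = r \<and> set is \<subseteq> {..<n}}"
  let ?T = "{is. set is \<subseteq> {..<n} \<and> length is = r}"
  let ?M = "{is. list_all2 (\<lambda>i u. i < length xs \<and> snd (xs ! i) = u) is (map us [1..<Suc r])}"
  note S = distinct_index_lists[of r n]
  have "?M \<subseteq> ?T"
    by (auto simp: list_all2_conv_all_nth in_set_conv_nth n_def)
  then have "\<bar>real (card (?S \<inter> ?M)) / card ?S - real (card ?M) / card ?T\<bar> \<le> 1 - real (card ?S) / card ?T"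
    using S assms by (intro restriction_ratio_le finite_lists_length_eq) (auto simp: n_def)
  moreover have T: "card ?T = n ^ r" by (subst card_lists_length_eq) auto
  moreover have "real (card ?M) / n ^ r = (\<Prod>w=1..r. length (filter (\<lambda>x. snd x = us w) xs) / n)"
  proof -
    have "card ?M = (\<Prod>w\<leftarrow>[1..<Suc r]. length (filter (\<lambda>x. snd x = us w) xs))"
      unfolding card_matching_lists by (simp add: comp_def del: upt_Suc)
    also have "\<dots> = (\<Prod>w\<in>set [1..<Suc r]. length (filter (\<lambda>x. snd x = us w) xs))"
      by (rule prod.distinct_set_conv_list[symmetric]) simp
    also have "set [1..<Suc r] = {1..r}" by auto
    finally show ?thesis by (simp add: prod_dividef)
  qed
  moreover have "matching_prob r us xs = real (card (?S \<inter> ?M)) / card ?S"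
    using S assms by (simp add: matching_prob_def measure_pmf_of_set n_def)
  moreover have "1 - real (card ?S) / real n ^ r \<le> 1 - (1 - r / n) ^ r"
    using distinct_lists_ratio_ge[of r n] assms by (simp add: n_def)
  ultimately show ?thesis by (simp add: n_def)
qed

lemma matching_prob_tendsto:
  assumes len: "filterlim length at_top F"
    and density: "\<And>w. w \<in> {1..r} \<Longrightarrow>
      ((\<lambda>xs. length (filter (\<lambda>x. snd x = us w) xs) / length xs) \<longlongrightarrow> d w) F"
  shows "(matching_prob r us \<longlongrightarrow> (\<Prod>w=1..r. d w)) F"
proof (rule Lim_transform)
  let ?P = "\<lambda>xs. \<Prod>w=1..r. length (filter (\<lambda>x. snd x = us w) xs) / length xs"
  show "(?P \<longlongrightarrow> (\<Prod>w=1..r. d w)) F"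
    using density by (rule tendsto_prod)
  have "(\<lambda>n. 1 - (1 - real r / real n) ^ r) \<longlonglongrightarrow> 1 - (1 - 0) ^ r"
    by (intro tendsto_intros lim_const_over_n)
  then have "((\<lambda>xs. 1 - (1 - real r / real (length xs)) ^ r) \<longlongrightarrow> 0) F"
    using filterlim_compose[OF _ len] by fastforce
  then show "((\<lambda>xs. matching_prob r us xs - ?P xs) \<longlongrightarrow> 0) F"
  proof (rule Lim_null_comparison[rotated])
    have "\<forall>\<^sub>F xs in F. r \<le> length xs \<and> Suc 0 \<le> length xs"
      using len by (auto simp: filterlim_at_top intro!: eventually_conj)
    then show "\<forall>\<^sub>F xs in F. norm (matching_prob r us xs - ?P xs) \<le> 1 - (1 - real r / real (length xs)) ^ r"
      by eventually_elim (use matching_prob_approx in fastforce)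
  qed
qed

section \<open>Convergence of the label proportions\<close>

context galton_watson
begin

lemma filterlim_length_generation:
  assumes \<kappa>: "\<And>i. i < l \<Longrightarrow> (\<integral>\<^sup>+ u. ennreal (1 / vnorm l u) \<partial>measure_pmf (p i)) \<le> ennreal \<kappa>" "\<kappa> \<ge> 0" "\<kappa> < 1"
    and i0: "i0 < l"
  shows "filterlim length at_top (whp (generation l p i0))"
  unfolding filterlim_at_top
proof
  fix k
  have "\<forall>\<^sub>F xs in whp (generation l p i0). \<not> length xs \<le> k"
    using generation_length_le_tendsto_0[OF \<kappa> i0, of k] by (simp add: eventually_whp)
  then show "\<forall>\<^sub>F xs in whp (generation l p i0). k \<le> length xs"
    by eventually_elim simp
qed

text \<open>Weak law for the labels: each one-sided deviation is excluded by the negativity, with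
  high probability, of the sum of an affine function of the label indicator.\<close>

lemma label_density_tendsto:
  assumes reg: "positively_regular l (mean_matrix p)" and \<rho>: "\<rho> > 0"
    and b_nonneg: "\<And>k. k < l \<Longrightarrow> b k \<ge> 0" and b_sum: "(\<Sum>k<l. b k) = 1"
    and b_eigen: "\<And>k. k < l \<Longrightarrow> (\<Sum>i<l. b i * mean_matrix p i k) = \<rho> * b k"
    and \<kappa>: "\<And>i. i < l \<Longrightarrow> (\<integral>\<^sup>+ u. ennreal (1 / vnorm l u) \<partial>measure_pmf (p i)) \<le> ennreal \<kappa>" "\<kappa> \<ge> 0" "\<kappa> < 1"
    and i0: "i0 < l"
  shows "((\<lambda>xs. length (filter (\<lambda>x. snd x = u) xs) / length xs) \<longlongrightarrow> size_biased l p b \<rho> u)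
           (whp (generation l p i0))"
proof (rule tendstoI)
  fix \<epsilon> :: real
  assume \<epsilon>: "\<epsilon> > 0"
  define s where "s = size_biased l p b \<rho> u"
  let ?G = "whp (generation l p i0)"
  let ?N = "\<lambda>xs. length (filter (\<lambda>x. snd x = u) xs)"
  \<comment> \<open>Since \<open>b\<close> has mass 1, the \<open>b\<close>-averaged mean family
    size is \<rho>, the normalizing constant of the size-biased law.\<close>
  have total: "(\<Sum>i<l. b i * (\<Sum>k<l. mean_matrix p i k)) = \<rho>"
  proof -
    have "(\<Sum>i<l. b i * (\<Sum>k<l. mean_matrix p i k)) = (\<Sum>k<l. \<Sum>i<l. b i * mean_matrix p i k)"
      unfolding sum_distrib_left by (rule sum.swap)
    then show ?thesis using b_sum by (simp add: b_eigen flip: sum_distrib_left)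
  qed
  have eventually_neg: "\<forall>\<^sub>F xs in ?G. \<alpha> * ?N xs + \<beta> * length xs < 0" if "\<alpha> * s + \<beta> < 0" for \<alpha> \<beta>
  proof -
    let ?g = "\<lambda>c :: nat \<times> (nat \<Rightarrow> nat). (if snd c = u then \<alpha> else 0) + \<beta>"
    have "(\<Sum>i<l. b i * offspring_mean ?g i) =
        \<alpha> * (vnorm l u * (\<Sum>i<l. b i * pmf (p i) u)) + \<beta> * (\<Sum>i<l. b i * (\<Sum>k<l. mean_matrix p i k))"
      unfolding sum_distrib_left[of \<alpha>] sum_distrib_left[of \<beta>] sum_distrib_left[of "real (vnorm l u)"]
        sum.distrib[symmetric]
      by (intro sum.cong) (auto simp: offspring_mean_label distrib_left mult_ac)
    also have "\<dots> = (\<alpha> * s + \<beta>) * \<rho>"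
      using \<rho> by (simp add: s_def size_biased_def total field_simps)
    also have "\<dots> < 0" using that \<rho> by (simp add: mult_neg_pos)
    finally have neg: "(\<Sum>i<l. b i * offspring_mean ?g i) < 0" .
    obtain m where m: "\<forall>i<l. (apply_mat l (mean_matrix p) ^^ m) (offspring_mean ?g) i < 0"
      using positively_regular_negative_iterate[OF reg _ \<rho> b_nonneg b_sum b_eigen neg] i0 by auto
    have bounded: "\<forall>c. fst c < l \<longrightarrow> \<bar>?g c\<bar> \<le> \<bar>\<alpha>\<bar> + \<bar>\<beta>\<bar>" by auto
    have "(\<Sum>c\<leftarrow>xs. ?g c) = \<alpha> * ?N xs + \<beta> * length xs" for xs
      by (induction xs) (auto simp: algebra_simps)
    then show ?thesis
      using generation_nonneg_tendsto_0[OF bounded m \<kappa> i0] by (simp add: eventually_whp not_less)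
  qed
  \<comment> \<open>Both choices of (\<alpha>, \<beta>) make \<open>\<alpha> * s + \<beta>\<close>
    equal to -\<epsilon>; they give the upper and the lower bound on the proportion.\<close>
  have "\<forall>\<^sub>F xs in ?G. 1 * real (?N xs) + (- s - \<epsilon>) * length xs < 0"
    using \<epsilon> by (intro eventually_neg) auto
  moreover have "\<forall>\<^sub>F xs in ?G. (- 1) * real (?N xs) + (s - \<epsilon>) * length xs < 0"
    using \<epsilon> by (intro eventually_neg) auto
  moreover have "\<forall>\<^sub>F xs in ?G. Suc 0 \<le> length xs"
    using filterlim_length_generation[OF \<kappa> i0] by (simp add: filterlim_at_top)
  ultimately show "\<forall>\<^sub>F xs in ?G. dist (?N xs / length xs) (size_biased l p b \<rho> u) < \<epsilon>"
  proof eventually_elim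
    case (elim xs)
    define N where "N = real (?N xs)"
    define n where "n = real (length xs)"
    have n: "n > 0" using elim(3) unfolding n_def by linarith
    have "N < (s + \<epsilon>) * n" "(s - \<epsilon>) * n < N"
      using elim(1,2) by (simp_all add: algebra_simps flip: N_def n_def)
    then have "N / n < s + \<epsilon>" "s - \<epsilon> < N / n" using n by (simp_all add: pos_divide_less_eq pos_less_divide_eq)
    then show ?case by (simp add: dist_real_def abs_less_iff flip: N_def n_def s_def)
  qed
qed

end

section \<open>Consequences of Assumption A1 and the conclusion\<close>

lemma vnorm_eq_0: "in_Nl l u \<Longrightarrow> vnorm l u = 0 \<Longrightarrow> u = (\<lambda>_. 0)"
  by (auto simp: vnorm_def in_Nl_def fun_eq_iff) (metis lessThan_iff not_less)

lemma vnorm_eq_1: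
  assumes "in_Nl l u" "vnorm l u = 1"
  shows "u \<in> unitvec ` {..<l}"
proof -
  from assms(2) obtain k where k: "k < l" "u k = 1" "\<And>j. j < l \<Longrightarrow> j \<noteq> k \<Longrightarrow> u j = 0"
    by (auto simp: vnorm_def sum_eq_Suc0_iff)
  have "u = unitvec k"
  proof
    fix j
    show "u j = unitvec k j"
      using k assms(1) by (cases "j < l") (auto simp: unitvec_def in_Nl_def)
  qed
  then show ?thesis using k by blast
qed

text \<open>The reciprocal is 1 on unit vectors and at most 1/2 on all other vectors of the support.
  Under A1 the resulting bound is strictly below 1.\<close>

lemma nn_integral_inverse_vnorm_le:
  assumes supp: "\<And>u. u \<in> set_pmf q \<Longrightarrow> in_Nl l u" and no_death: "pmf q (\<lambda>_. 0) = 0"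
  shows "(\<integral>\<^sup>+ u. ennreal (1 / vnorm l u) \<partial>measure_pmf q) \<le> ennreal (1/2 + (\<Sum>k<l. pmf q (unitvec k)) / 2)"
proof -
  have inj: "inj_on unitvec {..<l}"
    by (auto simp: inj_on_def unitvec_def fun_eq_iff)
  have "ennreal (1 / vnorm l u) \<le> ennreal (1/2) + ennreal (1/2) * indicator (unitvec ` {..<l}) u"
    if u: "u \<in> set_pmf q" for u
  proof (cases "vnorm l u = 1")
    case True
    then have "u \<in> unitvec ` {..<l}" using vnorm_eq_1 supp u by blast
    moreover have "ennreal (1/2) + ennreal (1/2) = ennreal 1" by (subst ennreal_plus[symmetric]) auto
    ultimately show ?thesis using True by simp
  next
    case False
    have "u \<noteq> (\<lambda>_. 0)" using u no_death by (auto simp: set_pmf_iff)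
    then have "vnorm l u \<ge> 2" using False vnorm_eq_0[OF supp[OF u]] by linarith
    then have "ennreal (1 / vnorm l u) \<le> ennreal (1/2)" by (intro ennreal_leI) (simp add: divide_simps)
    then show ?thesis by (simp add: add_increasing2)
  qed
  then have "(\<integral>\<^sup>+ u. ennreal (1 / vnorm l u) \<partial>measure_pmf q)
      \<le> (\<integral>\<^sup>+ u. ennreal (1/2) + ennreal (1/2) * indicator (unitvec ` {..<l}) u \<partial>measure_pmf q)"
    by (intro nn_integral_mono_AE) (simp add: AE_measure_pmf_iff)
  also have "\<dots> = ennreal (1/2) + ennreal (1/2) * emeasure (measure_pmf q) (unitvec ` {..<l})"
    by (simp add: nn_integral_add nn_integral_cmult measure_pmf.emeasure_space_1[simplified])
  also have "emeasure (measure_pmf q) (unitvec ` {..<l}) = ennreal (\<Sum>k<l. pmf q (unitvec k))"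
    using inj by (simp add: measure_pmf.emeasure_eq_measure measure_measure_pmf_finite sum.reindex)
  also have "ennreal (1/2) + ennreal (1/2) * \<dots> = ennreal (1/2 + (\<Sum>k<l. pmf q (unitvec k)) / 2)"
    by (subst ennreal_mult[symmetric], simp, simp add: sum_nonneg, subst ennreal_plus[symmetric])
      (auto intro!: sum_nonneg)
  finally show ?thesis .
qed

theorem theorem4p1:
  fixes l r i0 :: nat and p :: "nat \<Rightarrow> (nat \<Rightarrow> nat) pmf"
    and \<rho> C K :: real and b :: "nat \<Rightarrow> real" and us :: "nat \<Rightarrow> nat \<Rightarrow> nat"
  assumes l2: "l \<ge> 2" and i0: "i0 < l" and r1: "r \<ge> 1"
    and support: "\<forall>i<l. \<forall>u\<in>set_pmf (p i). in_Nl l u"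
    and A1: "\<forall>j<l. pmf (p j) (\<lambda>_. 0) = 0 \<and> (\<Sum>k<l. pmf (p j) (unitvec k)) < 1"
    and A2_reg: "positively_regular l (mean_matrix p)"
    and A2_rho: "largest_eigenvalue l (mean_matrix p) \<rho>" and A2_gt: "\<rho> > 1"
    and A2_b: "(\<forall>k<l. b k \<ge> 0) \<and> (\<Sum>k<l. b k) = 1 \<and>
               (\<forall>k<l. (\<Sum>i<l. b i * mean_matrix p i k) = \<rho> * b k)"
    and A3_i: "(\<lambda>n. real r ^ 2 / \<rho> ^ n) \<longlonglongrightarrow> 0"
    and A3_ii: "\<forall>i<l. (\<integral>\<^sup>+ u. ennreal (real (vnorm l u) ^ 2) \<partial>measure_pmf (p i)) \<le> ennreal C"
    and A3_iii: "\<forall>i<l. (\<integral>\<^sup>+ u. ennreal (1 / real (vnorm l u)) \<partial>measure_pmf (p i)) \<le> ennreal K"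
    and us: "\<forall>w\<in>{1..r}. in_Nl l (us w)"
  shows "(\<lambda>n. measure_pmf.prob (sample_reports l p i0 r n)
            {ob. \<exists>xs. ob = Some xs \<and> (\<forall>w\<in>{1..r}. xs ! (w - 1) = us w)})
         \<longlonglongrightarrow> (\<Prod>w=1..r. size_biased l p b \<rho> (us w))"
proof -
  \<comment> \<open>Truncating \<open>C\<close> at 0 supplies the sign required by the locale and
    only weakens the moment bound.\<close>
  interpret galton_watson l p "max C 0"
  proof
    show "(\<integral>\<^sup>+ u. ennreal ((real (vnorm l u))\<^sup>2) \<partial>measure_pmf (p i)) \<le> ennreal (max C 0)" if "i < l" for i
      using A3_ii that by (auto intro: order.trans ennreal_leI)
    show "vnorm l u \<ge> 1" if "i < l" "u \<in> set_pmf (p i)" for i u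
      using vnorm_eq_0[of l u] support A1 that by (fastforce simp: set_pmf_iff Suc_le_eq)
  qed simp
  define q where "q = (\<lambda>j. \<Sum>k<l. pmf (p j) (unitvec k))"
  \<comment> \<open>The worst reciprocal bound over the finitely many types; the maximum keeps the
    strict inequality of A1.\<close>
  define \<kappa> where "\<kappa> = 1/2 + Max (q ` {..<l}) / 2"
  have q_le: "q j \<le> Max (q ` {..<l})" if "j < l" for j using that by (intro Max_ge) auto
  have "Max (q ` {..<l}) < 1" using A1 i0 by (subst Max_less_iff) (auto simp: q_def)
  then have \<kappa>_less: "\<kappa> < 1" by (simp add: \<kappa>_def)
  have \<kappa>_nonneg: "\<kappa> \<ge> 0"
    using q_le[OF i0] sum_nonneg[of "{..<l}" "\<lambda>k. pmf (p i0) (unitvec k)"] by (simp add: \<kappa>_def q_def)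
  have \<kappa>_bound: "(\<integral>\<^sup>+ u. ennreal (1 / vnorm l u) \<partial>measure_pmf (p i)) \<le> ennreal \<kappa>" if i: "i < l" for i
  proof (rule order.trans[OF nn_integral_inverse_vnorm_le])
    show "ennreal (1/2 + (\<Sum>k<l. pmf (p i) (unitvec k)) / 2) \<le> ennreal \<kappa>"
      using q_le[OF i] by (intro ennreal_leI) (simp add: \<kappa>_def q_def)
  qed (use support A1 i in auto)
  have "(matching_prob r us \<longlongrightarrow> (\<Prod>w=1..r. size_biased l p b \<rho> (us w))) (whp (generation l p i0))"
    using A2_reg A2_gt A2_b \<kappa>_bound \<kappa>_nonneg \<kappa>_less i0
    by (intro matching_prob_tendsto filterlim_length_generation label_density_tendsto) auto
  then show ?thesis
    unfolding prob_sample_reports by (rule expectation_tendsto_whp) (auto simp: matching_prob_def)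
qed

end
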